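(* For all integers $\alpha \geq 1$ and $n \geq 0$, $$\Delta_3(\lambda_{\alpha})\,\Delta_3(2^{\alpha+2}n+\lambda_{\alpha+2})\equiv \Delta_3(\lambda_{\alpha+2})\,\Delta_3(2^{\alpha}n+\lambda_{\alpha}) \pmod{2^{2\lfloor \alpha/2\rfloor}},$$ where $\lambda_\alpha=\frac{2^{\alpha+1}+1}{3}$ if $\alpha$ is even and $\lambda_\alpha=\frac{2^{\alpha}+1}{3}$ if $\alpha$ is odd.
   Context: $\Delta_3(n)$ denotes the number of broken $3$-diamond partitions of $n$; it is given by the generating function $$\sum_{n=0}^{\infty}\Delta_3(n)q^n=\prod_{n=1}^{\infty}\frac{(1-q^{2n})(1-q^{7n})}{(1-q^n)^3(1-q^{14n})}.$$ *)

theory Defs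
  imports
    "HOL-Analysis.Infinite_Products"
    "HOL-Computational_Algebra.Formal_Power_Series"
    "HOL-Number_Theory.Cong"
begin

definition broken_3_diamond_num :: "nat \<Rightarrow> int fps" where
  "broken_3_diamond_num n = (1 - fps_X ^ (2 * n)) * (1 - fps_X ^ (7 * n))"

definition broken_3_diamond_denom :: "nat \<Rightarrow> int fps" where
  "broken_3_diamond_denom n = (1 - fps_X ^ n) ^ 3 * (1 - fps_X ^ (14 * n))"

text \<open>
  There is no division on \<^typ>\<open>int fps\<close>, so the quotient is formed with
  \<^const>\<open>fps_right_inverse\<close>, whose second argument is the inverse of the constant
  coefficient. For positive \<open>n\<close> that coefficient is \<open>1\<close>, see
  \<open>broken_3_diamond_factor_mult_denom\<close> below.
\<close>

definition broken_3_diamond_factor :: "nat \<Rightarrow> int fps" where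
  "broken_3_diamond_factor n =
     broken_3_diamond_num n * fps_right_inverse (broken_3_diamond_denom n) 1"

text \<open>
  The number of broken 3-diamond partitions of \<open>n\<close>, given by its generating function.
  The infinite product is taken in the usual topology of formal power series; it starts at index
  \<open>0\<close>, hence the \<^const>\<open>Suc\<close>.
\<close>

definition broken_3_diamond :: "nat \<Rightarrow> int" where
  "broken_3_diamond n = fps_nth (\<Prod>k. broken_3_diamond_factor (Suc k)) n"

definition broken_3_diamond_lambda :: "nat \<Rightarrow> nat" where
  "broken_3_diamond_lambda a = (if even a then (2 ^ (a + 1) + 1) div 3 else (2 ^ a + 1) div 3)"

text \<open>The division in the last definition is exact.\<close>

lemma three_dvd_two_power_odd:
  assumes "odd (m :: nat)"
  shows "3 dvd (2 ^ m + 1 :: nat)"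
proof -
  obtain k where k: "m = 2 * k + 1"
    using assms by (elim oddE)
  have "3 dvd (2 ^ (2 * k + 1) + 1 :: nat)"
  proof (induction k)
    case (Suc k)
    have "2 ^ (2 * Suc k + 1) + 1 = (2 ^ (2 * k + 1) + 1 :: nat) + 3 * 2 ^ (2 * k + 1)"
      by (simp add: algebra_simps)
    with Suc.IH show ?case
      by (metis dvd_add dvd_triv_left)
  qed (simp add: numeral_eq_Suc)
  with k show ?thesis by simp
qed

lemma three_mult_broken_3_diamond_lambda:
  "3 * broken_3_diamond_lambda a = (if even a then 2 ^ (a + 1) + 1 else 2 ^ a + 1)"
  using three_dvd_two_power_odd[of a] three_dvd_two_power_odd[of "a + 1"]
  by (auto simp: broken_3_diamond_lambda_def)

text \<open>The quotient is the expected one and the product converges.\<close>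

lemma broken_3_diamond_denom_nth_0:
  "n > 0 \<Longrightarrow> fps_nth (broken_3_diamond_denom n) 0 = 1"
  by (simp add: broken_3_diamond_denom_def fps_nth_power_0 zero_power)

lemma broken_3_diamond_factor_mult_denom:
  assumes "n > 0"
  shows "broken_3_diamond_factor n * broken_3_diamond_denom n = broken_3_diamond_num n"
proof -
  have "broken_3_diamond_denom n * fps_right_inverse (broken_3_diamond_denom n) 1 = 1"
    by (rule fps_right_inverse) (simp add: broken_3_diamond_denom_nth_0 assms)
  thus ?thesis
    by (simp add: broken_3_diamond_factor_def mult.assoc mult.commute)
qed

lemma broken_3_diamond_factor_eq_1_plus:
  assumes "n > 0"
  shows "\<exists>g. broken_3_diamond_factor n = 1 + fps_X ^ n * g"
proof -
  let ?I = "fps_right_inverse (broken_3_diamond_denom n) 1"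
  have X: "fps_X ^ (c * n) = (fps_X ^ n) ^ c" for c :: nat
    by (simp add: power_mult [symmetric] mult.commute)
  have "(fps_X ^ n :: int fps) dvd broken_3_diamond_num n - broken_3_diamond_denom n"
  proof -
    define x where "x = (fps_X ^ n :: int fps)"
    have "broken_3_diamond_num n - broken_3_diamond_denom n =
            (1 - x^2) * (1 - x^7) - (1 - x)^3 * (1 - x^14)"
      by (simp only: broken_3_diamond_num_def broken_3_diamond_denom_def X x_def)
    also have "\<dots> = (1 - x * x) * (1 - x * x^6) - (1 - x * (3 - 3 * x + x * x)) * (1 - x * x^13)"
    proof -
      have "(1 - x)^3 = 1 - x * (3 - 3 * x + x * x)"
        by (simp add: power3_eq_cube algebra_simps)
      moreover have "x^2 = x * x" "x^7 = x * x^6" "x^14 = x * x^13"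
        by (simp_all flip: power_Suc add: power2_eq_square)
      ultimately show ?thesis by (simp only:)
    qed
    also have "x dvd \<dots>"
    proof -
      have "(1 - x * x) * (1 - x * a) - (1 - x * c) * (1 - x * b) =
              x * (c + b - x - a + x * x * a - x * c * b)" for a b c :: "int fps"
        by (simp add: algebra_simps)
      thus ?thesis by (simp only: dvd_triv_left)
    qed
    finally show ?thesis unfolding x_def .
  qed
  then obtain h where "broken_3_diamond_num n - broken_3_diamond_denom n = fps_X ^ n * h"
    by (elim dvdE)
  hence "broken_3_diamond_num n = broken_3_diamond_denom n + fps_X ^ n * h"
    by (simp only: diff_eq_eq add.commute)
  moreover have "broken_3_diamond_denom n * ?I = 1"
    by (rule fps_right_inverse) (simp add: broken_3_diamond_denom_nth_0 assms)
  ultimately have "broken_3_diamond_factor n = 1 + fps_X ^ n * (h * ?I)"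
    by (simp only: broken_3_diamond_factor_def distrib_right mult.assoc)
  thus ?thesis by blast
qed

lemma broken_3_diamond_partial_prod_nth:
  assumes "k \<le> m"
  shows "fps_nth (\<Prod>i\<le>m. broken_3_diamond_factor (Suc i)) k =
         fps_nth (\<Prod>i\<le>k. broken_3_diamond_factor (Suc i)) k"
  using assms
proof (induction m rule: dec_induct)
  case (step m)
  obtain g where g: "broken_3_diamond_factor (Suc (Suc m)) = 1 + fps_X ^ Suc (Suc m) * g"
    using broken_3_diamond_factor_eq_1_plus[OF zero_less_Suc] by blast
  have "fps_nth (P * (1 + fps_X ^ Suc (Suc m) * g)) k = fps_nth P k" for P
  proof -
    have "P * (1 + fps_X ^ Suc (Suc m) * g) = P + fps_X ^ Suc (Suc m) * (P * g)"
      by (simp only: distrib_left mult_1_right mult.left_commute)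
    moreover have "fps_nth (fps_X ^ Suc (Suc m) * (P * g)) k = 0"
      unfolding fps_X_power_mult_nth using step by simp
    ultimately show ?thesis by (metis fps_add_nth add.right_neutral)
  qed
  thus ?case using step by (simp only: prod.atMost_Suc g)
qed simp

lemma broken_3_diamond_has_prod:
  "(\<lambda>k. broken_3_diamond_factor (Suc k)) has_prod Abs_fps broken_3_diamond"
proof -
  let ?f = "\<lambda>k. broken_3_diamond_factor (Suc k)"
  define p where "p = Abs_fps (\<lambda>k. fps_nth (\<Prod>i\<le>k. ?f i) k)"
  have "(\<lambda>n. \<Prod>i\<le>n. ?f i) \<longlonglongrightarrow> p"
    unfolding tendsto_fps_iff
  proof
    fix k
    show "\<forall>\<^sub>F n in sequentially. fps_nth (\<Prod>i\<le>n. ?f i) k = fps_nth p k"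
      using eventually_ge_at_top[of k]
      by eventually_elim (unfold p_def fps_nth_Abs_fps, rule broken_3_diamond_partial_prod_nth)
  qed
  moreover have "fps_nth p 0 = 1"
  proof -
    obtain g where "?f 0 = 1 + fps_X ^ Suc 0 * g"
      using broken_3_diamond_factor_eq_1_plus[OF zero_less_Suc] by blast
    thus ?thesis by (simp add: p_def)
  qed
  hence "p \<noteq> 0" by auto
  ultimately have "?f has_prod p"
    by (simp add: has_prod_def raw_has_prod_def)
  moreover from this have "p = prodinf ?f"
    by (rule has_prod_unique)
  hence "Abs_fps broken_3_diamond = p"
    by (simp add: fps_eq_iff broken_3_diamond_def)
  ultimately show ?thesis by simp
qed

end

theory Submission
  imports Defs "HOL-Computational_Algebra.Formal_Laurent_Series"
begin

text \<open>
  Write \<open>f\<^sub>k\<close> for the product of the \<open>1 - q ^ (k * i)\<close>. With \<open>tau = \<phi>(-q\<^sup>7) / \<phi>(-q)\<close> the generating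
  function is \<open>tau / (f\<^sub>1 f\<^sub>7)\<close>. Passing to every second coefficient, the progressions of the theorem
  become an eta quotient times \<open>tau\<close> times a power series, and on that last factor the passage acts
  by the even part of a multiplication by \<open>tau(q) / tau(q\<^sup>2)\<close> and by powers of \<open>rho = q f\<^sub>4 f\<^sub>2\<^sub>8 / (f\<^sub>1 f\<^sub>7)\<close>.

  The identity \<open>\<psi>(q) \<psi>(q\<^sup>7) - \<psi>(-q) \<psi>(-q\<^sup>7) = 2 q \<psi>(q\<^sup>2) \<psi>(q\<^sup>1\<^sup>4)\<close>, a bijection between
  representations by \<open>a\<^sup>2 + 7 b\<^sup>2\<close> given by multiplication with \<open>(1 \<plusminus> \<surd>-7) / 2\<close>, makes \<open>rho\<close> quadratic over
  the series in \<open>q\<^sup>2\<close>; together with Jacobi's quartic identity it yields the degree 7 modular equation and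
  hence the trace of \<open>tau(q) / tau(q\<^sup>2)\<close>. So the operator becomes explicit on polynomials in \<open>rho\<close> with
  respect to two basis elements \<open>alpha\<close> and \<open>beta\<close>.

  Two steps of the operator preserve a lattice of such polynomials with growing powers of 2 in the
  coefficients, and have rank one modulo 4 there. Hence they multiply every \<open>2 \<times> 2\<close> minor by a multiple
  of 4, and the two sides of the congruence differ by such a minor after \<open>\<alpha> div 2\<close> double steps.
\<close>

section \<open>Dilation and parity of power series\<close>

text \<open>The substitutions q -> q^c and, for \<open>alt\<close>, q -> -q, written as compositions
  so that the ring laws are inherited.\<close>

definition dil :: "nat \<Rightarrow> int fps \<Rightarrow> int fps" where
  "dil c F = F oo fps_X ^ c"

definition alt :: "int fps \<Rightarrow> int fps" where
  "alt F = F oo (- fps_X)"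

lemma dil_nth: "fps_nth (dil c F) n = (if c dvd n then fps_nth F (n div c) else 0)"
  by (simp add: dil_def fps_nth_compose_X_power)

lemma alt_nth: "fps_nth (alt F) n = (-1) ^ n * fps_nth F n"
  by (simp add: alt_def fps_compose_uminus')

lemma dil_add: "dil c (F + G) = dil c F + dil c G"
  and dil_diff: "dil c (F - G) = dil c F - dil c G"
  and dil_uminus: "dil c (- F) = - dil c F"
  and dil_0: "dil c 0 = 0"
  and dil_1: "dil c 1 = 1"
  and dil_numeral: "dil c (numeral k) = numeral k"
  by (simp_all add: dil_def fps_compose_add_distrib fps_compose_sub_distrib fps_compose_uminus)

lemma dil_mult: "c > 0 \<Longrightarrow> dil c (F * G) = dil c F * dil c G"
  and dil_power: "c > 0 \<Longrightarrow> dil c (F ^ k) = dil c F ^ k"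
  and dil_X: "c > 0 \<Longrightarrow> dil c fps_X = fps_X ^ c"
  and dil_prod: "c > 0 \<Longrightarrow> dil c (prod f S) = (\<Prod>i\<in>S. dil c (f i))"
  by (simp_all add: dil_def fps_compose_mult_distrib fps_compose_power fps_compose_prod_distrib)

lemma dil_dil: "dil c (dil d F) = dil (c * d) F"
proof (cases "c = 0 \<or> d = 0")
  case True
  thus ?thesis by (auto simp: fps_eq_iff dil_nth)
next
  case False
  hence "c * d dvd n \<longleftrightarrow> c dvd n \<and> d dvd n div c" for n
    by (auto simp: dvd_mult_imp_div dvd_div_iff_mult mult.commute elim: dvd_mult_left dvd_mult_right)
  thus ?thesis
    by (auto simp: fps_eq_iff dil_nth div_mult2_eq)
qed

lemma dil_inject: "c > 0 \<Longrightarrow> dil c F = dil c G \<longleftrightarrow> F = G"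
proof
  assume c: "c > 0" and eq: "dil c F = dil c G"
  show "F = G"
  proof (rule fps_ext)
    fix n
    have "fps_nth (dil c F) (c * n) = fps_nth (dil c G) (c * n)"
      by (simp only: eq)
    thus "fps_nth F n = fps_nth G n"
      using c by (simp add: dil_nth)
  qed
qed simp

lemmas dil_simps = dil_add dil_diff dil_uminus dil_0 dil_1 dil_numeral dil_mult dil_power dil_X dil_dil

lemma alt_add: "alt (F + G) = alt F + alt G"
  and alt_diff: "alt (F - G) = alt F - alt G"
  and alt_uminus: "alt (- F) = - alt F"
  and alt_0: "alt 0 = 0"
  and alt_1: "alt 1 = 1"
  and alt_numeral: "alt (numeral k) = numeral k"
  by (simp_all add: alt_def fps_compose_add_distrib fps_compose_sub_distrib fps_compose_uminus)

lemma alt_mult: "alt (F * G) = alt F * alt G"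
  and alt_power: "alt (F ^ k) = alt F ^ k"
  and alt_X: "alt fps_X = - fps_X"
  and alt_prod: "alt (prod f S) = (\<Prod>i\<in>S. alt (f i))"
  by (simp_all add: alt_def fps_compose_mult_distrib fps_compose_power fps_compose_prod_distrib)

lemma alt_alt: "alt (alt F) = F"
  by (simp add: fps_eq_iff alt_nth flip: mult.assoc power_mult_distrib)

lemma alt_dil_even: "even c \<Longrightarrow> alt (dil c F) = dil c F"
  by (auto simp: fps_eq_iff alt_nth dil_nth elim!: dvdE)

lemma alt_dil_odd: "odd c \<Longrightarrow> alt (dil c F) = dil c (alt F)"
  by (simp add: fps_eq_iff alt_nth dil_nth uminus_power_if) (metis dvd_div_mult_self even_mult_iff)

lemmas alt_simps = alt_add alt_diff alt_uminus alt_0 alt_1 alt_numeral alt_mult alt_power alt_X alt_alt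

section \<open>Splitting a series by the parity of exponents\<close>

definition even_part :: "int fps \<Rightarrow> int fps" where
  "even_part F = Abs_fps (\<lambda>n. fps_nth F (2 * n))"

definition odd_part :: "int fps \<Rightarrow> int fps" where
  "odd_part F = Abs_fps (\<lambda>n. fps_nth F (2 * n + 1))"

lemma even_odd_split: "F = dil 2 (even_part F) + fps_X * dil 2 (odd_part F)"
proof (rule fps_ext)
  fix n
  show "fps_nth F n = fps_nth (dil 2 (even_part F) + fps_X * dil 2 (odd_part F)) n"
    by (cases "even n") (auto simp: dil_nth even_part_def odd_part_def elim!: evenE oddE)
qed

lemma even_part_eq: "even_part (dil 2 F + fps_X * dil 2 G) = F"
  and odd_part_eq: "odd_part (dil 2 F + fps_X * dil 2 G) = G"
  by (auto simp: fps_eq_iff even_part_def odd_part_def dil_nth fps_X_mult_nth split: if_splits)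

lemma even_part_add: "even_part (F + G) = even_part F + even_part G"
  by (simp add: even_part_def fps_eq_iff)

lemma even_part_mult_dil: "even_part (dil 2 G * F) = G * even_part F"
proof -
  have "dil 2 G * F = dil 2 (G * even_part F) + fps_X * dil 2 (G * odd_part F)"
    by (subst even_odd_split[of F]) (simp add: dil_mult algebra_simps)
  thus ?thesis by (simp only: even_part_eq)
qed

lemma odd_part_mult_dil: "odd_part (dil 2 G * F) = G * odd_part F"
proof -
  have "dil 2 G * F = dil 2 (G * even_part F) + fps_X * dil 2 (G * odd_part F)"
    by (subst even_odd_split[of F]) (simp add: dil_mult algebra_simps)
  thus ?thesis by (simp only: odd_part_eq)
qed

lemma odd_part_X_mult: "odd_part (fps_X * F) = even_part F"
  by (simp add: odd_part_def even_part_def fps_eq_iff)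

text \<open>Even exponents are selected by averaging over q -> -q; the factor 2 stays on the left
  because the coefficients are integers.\<close>

lemma even_part_doubled: "2 * dil 2 (even_part F) = F + alt F"
  by (subst (2 3) even_odd_split[of F]) (simp add: alt_simps alt_dil_even)

lemma odd_part_doubled: "2 * (fps_X * dil 2 (odd_part F)) = F - alt F"
  by (subst (2 3) even_odd_split[of F]) (simp add: alt_simps alt_dil_even)

text \<open>The ring is an integral domain, so only the sign is open, and the constant coefficient
  decides it.\<close>

lemma power2_eq_imp_eq_fps:
  assumes "F\<^sup>2 = G\<^sup>2" "fps_nth F 0 = fps_nth G 0" "fps_nth G 0 \<noteq> (0 :: int)"
  shows "F = G"
proof -
  have "F = G \<or> F = - G"
    using assms(1) by (simp add: power2_eq_iff)
  moreover have "F \<noteq> - G"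
  proof
    assume "F = - G"
    hence "fps_nth F 0 = - fps_nth G 0" by simp
    with assms show False by simp
  qed
  ultimately show ?thesis by blast
qed

section \<open>Euler products\<close>

text \<open>An infinite product without topology: coefficient n is taken from the product truncated
  at n. This is meaningful for \<open>tame\<close> families, where factor i is 1 up to terms of
  order i + 1.\<close>

definition eprod :: "(nat \<Rightarrow> int fps) \<Rightarrow> int fps" where
  "eprod g = Abs_fps (\<lambda>n. fps_nth (\<Prod>i\<le>n. g i) n)"

definition tame :: "(nat \<Rightarrow> int fps) \<Rightarrow> bool" where
  "tame g \<longleftrightarrow> (\<forall>i. fps_X ^ Suc i dvd g i - 1)"

lemma fps_nth_mult_cong:
  assumes "\<And>k. k \<le> n \<Longrightarrow> fps_nth F k = fps_nth F' k" "\<And>k. k \<le> n \<Longrightarrow> fps_nth G k = fps_nth G' k"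
  shows "fps_nth (F * G) n = fps_nth (F' * G') n"
  unfolding fps_mult_nth by (intro sum.cong) (auto simp: assms)

lemma eprod_nth:
  assumes "tame g" "k \<le> m"
  shows "fps_nth (\<Prod>i\<le>m. g i) k = fps_nth (eprod g) k"
  using assms(2)
proof (induction m rule: dec_induct)
  case base
  show ?case by (simp add: eprod_def)
next
  case (step m)
  obtain h where h: "g (Suc m) - 1 = fps_X ^ Suc (Suc m) * h"
    using assms(1) unfolding tame_def by (meson dvdE)
  hence "g (Suc m) = 1 + fps_X ^ Suc (Suc m) * h"
    by (simp add: algebra_simps)
  hence "(\<Prod>i\<le>Suc m. g i) = (\<Prod>i\<le>m. g i) + fps_X ^ Suc (Suc m) * ((\<Prod>i\<le>m. g i) * h)"
    by (simp only: prod.atMost_Suc distrib_left mult_1_right mult.left_commute)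
  hence "fps_nth (\<Prod>i\<le>Suc m. g i) k = fps_nth (\<Prod>i\<le>m. g i) k"
    using step by (simp add: fps_X_power_mult_nth del: prod.atMost_Suc power_Suc)
  thus ?case using step by simp
qed

lemma eprod_mult:
  assumes "tame g" "tame h"
  shows "eprod g * eprod h = eprod (\<lambda>i. g i * h i)"
proof (rule fps_ext)
  fix n
  have "fps_nth (eprod g * eprod h) n = fps_nth ((\<Prod>i\<le>n. g i) * (\<Prod>i\<le>n. h i)) n"
    by (intro fps_nth_mult_cong) (simp_all add: eprod_nth assms)
  thus "fps_nth (eprod g * eprod h) n = fps_nth (eprod (\<lambda>i. g i * h i)) n"
    by (simp add: eprod_def prod.distrib)
qed

lemma tame_mult:
  assumes "tame g" "tame h"
  shows "tame (\<lambda>i. g i * h i)"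
  unfolding tame_def
proof
  fix i
  have "g i * h i - 1 = (g i - 1) * h i + (h i - 1)"
    by (simp add: algebra_simps)
  thus "fps_X ^ Suc i dvd g i * h i - 1"
    using assms unfolding tame_def by (simp only: dvd_add dvd_mult2)
qed

lemma dil_eprod:
  assumes "tame g" "c > 0"
  shows "dil c (eprod g) = eprod (\<lambda>i. dil c (g i))"
proof (rule fps_ext)
  fix n
  have "fps_nth (dil c (eprod g)) n = fps_nth (dil c (\<Prod>i\<le>n. g i)) n"
    by (simp add: dil_nth eprod_nth assms)
  thus "fps_nth (dil c (eprod g)) n = fps_nth (eprod (\<lambda>i. dil c (g i))) n"
    by (simp add: eprod_def dil_prod assms)
qed

lemma alt_eprod: "alt (eprod g) = eprod (\<lambda>i. alt (g i))"
  by (simp add: fps_eq_iff eprod_def alt_nth flip: alt_prod)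

lemma X_power_dvd_one_plus:
  assumes "m > i"
  shows "fps_X ^ Suc i dvd (1 + c * fps_X ^ m :: int fps) - 1"
  using assms by (simp add: le_imp_power_dvd dvd_mult del: power_Suc)

lemma X_power_dvd_one_minus:
  assumes "m > i"
  shows "fps_X ^ Suc i dvd (1 - fps_X ^ m :: int fps) - 1"
  using X_power_dvd_one_plus[OF assms, of "-1"] by (simp del: power_Suc)

section \<open>Euler's product and its splitting by parity\<close>

definition euler :: "int fps" where
  "euler = eprod (\<lambda>i. 1 - fps_X ^ Suc i)"

definition euler_odd :: "int fps" where
  "euler_odd = eprod (\<lambda>i. 1 - fps_X ^ (2 * i + 1))"

lemma tame_euler: "c > 0 \<Longrightarrow> tame (\<lambda>i. 1 - fps_X ^ (c * Suc i))"
  unfolding tame_def by (intro allI X_power_dvd_one_minus, rule less_le_trans[OF lessI], simp del: mult_Suc_right)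

lemma tame_euler_odd: "tame (\<lambda>i. 1 - fps_X ^ (2 * i + 1))"
  unfolding tame_def by (intro allI X_power_dvd_one_minus) simp

lemma dil_euler: "c > 0 \<Longrightarrow> dil c euler = eprod (\<lambda>i. 1 - fps_X ^ (c * Suc i))"
  using tame_euler[of 1]
  by (simp add: euler_def dil_eprod dil_simps flip: power_mult power_Suc)

lemma euler_nth_0: "fps_nth euler 0 = 1"
  by (simp add: euler_def eprod_def)

lemma euler_eq_odd_mult: "euler = euler_odd * dil 2 euler"
proof (rule fps_ext)
  fix n
  have prods: "(\<Prod>i\<le>n. (1 - fps_X ^ (2 * i + 1)) * (1 - fps_X ^ (2 * Suc i))) = (\<Prod>i\<le>2 * n + 1. 1 - fps_X ^ Suc i :: int fps)" for n
    by (induction n) (simp_all add: mult.assoc power2_eq_square)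
  \<comment> \<open>Coefficient \<open>n\<close> may be read off any longer truncation; the one at
    \<open>2 * n + 1\<close> consists exactly of the pairs in \<open>prods\<close>.\<close>
  have "fps_nth euler n = fps_nth (\<Prod>i\<le>2 * n + 1. 1 - fps_X ^ Suc i) n"
    unfolding euler_def using tame_euler[of 1] by (subst eprod_nth) simp_all
  also have "\<dots> = fps_nth (eprod (\<lambda>i. (1 - fps_X ^ (2 * i + 1)) * (1 - fps_X ^ (2 * Suc i)))) n"
    by (simp only: prods[symmetric] eprod_def fps_nth_Abs_fps)
  also have "\<dots> = fps_nth (euler_odd * dil 2 euler) n"
    using tame_euler_odd tame_euler[of 2] by (simp only: euler_odd_def dil_euler eprod_mult zero_less_numeral)
  finally show "fps_nth euler n = fps_nth (euler_odd * dil 2 euler) n" .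
qed

lemma euler_odd_mult_alt: "euler_odd * alt euler_odd = dil 2 euler_odd"
proof -
  have "tame (\<lambda>i. alt (1 - fps_X ^ (2 * i + 1)))"
    unfolding tame_def using X_power_dvd_one_plus[of _ _ 1] by (simp add: alt_simps del: power_Suc)
  thus ?thesis
    using tame_euler_odd
    by (simp add: euler_odd_def alt_eprod eprod_mult dil_eprod alt_simps dil_simps algebra_simps
                  flip: power_Suc power_mult power_add)
qed

text \<open>The product form f_2^3 / (f_1 f_4) of Euler's product at -q; only the factors with odd
  exponent change.\<close>

lemma alt_euler: "alt euler * euler * dil 4 euler = dil 2 euler ^ 3"
proof -
  have 1: "alt euler = alt euler_odd * dil 2 euler"
    by (subst euler_eq_odd_mult) (simp add: alt_mult alt_dil_even)
  have "dil 2 euler = dil 2 euler_odd * dil 4 euler"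
    by (subst euler_eq_odd_mult) (simp add: dil_simps)
  hence 2: "dil 2 euler = euler_odd * alt euler_odd * dil 4 euler"
    by (simp add: euler_odd_mult_alt)
  have "alt euler * euler * dil 4 euler = (euler_odd * alt euler_odd * dil 4 euler) * dil 2 euler * dil 2 euler"
    by (subst 1, subst (2) euler_eq_odd_mult) (simp add: mult_ac)
  thus ?thesis by (simp add: 2[symmetric] power3_eq_cube)
qed

section \<open>Gauss' theta series\<close>

text \<open>Over all integers k, the numbers k (2k + 1) run through every triangular number exactly
  once, so this is Gauss' series. Cardinalities as coefficients allow proofs by bijection.\<close>

definition psi :: "int fps" where
  "psi = Abs_fps (\<lambda>n. int (card {k :: int. k * (2 * k + 1) = int n}))"

definition phi :: "int fps" where
  "phi = Abs_fps (\<lambda>n. int (card {k :: int. k\<^sup>2 = int n}))"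

lemma fps_nth_sum_X_power:
  assumes "finite S" "\<And>k. e k \<ge> (0 :: int)"
  shows "fps_nth (\<Sum>k\<in>S. fps_X ^ nat (e k) :: int fps) n = int (card {k \<in> S. e k = int n})"
proof -
  have "fps_nth (\<Sum>k\<in>S. fps_X ^ nat (e k) :: int fps) n = (\<Sum>k\<in>S. if e k = int n then 1 else 0)"
    unfolding fps_sum_nth using assms(2) by (intro sum.cong) (auto simp: nat_eq_iff)
  also have "\<dots> = int (card {k \<in> S. e k = int n})"
    using assms(1) by (simp add: sum.If_cases Int_def)
  finally show ?thesis .
qed

lemma abs_le_two_triangle: "\<bar>k\<bar> \<le> k * (2 * k + 1)" for k :: int
proof (cases "k \<ge> 0")
  case True
  thus ?thesis using mult_left_mono[of 1 "2 * k + 1" k] by simp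
next
  case False
  hence "k * (2 * k + 1) \<ge> k * (- 1)"
    by (intro mult_left_mono_neg) auto
  thus ?thesis using False by simp
qed

lemma abs_le_power2_int: "\<bar>k\<bar> \<le> k\<^sup>2" for k :: int
proof -
  have "\<bar>k\<bar> * 1 \<le> \<bar>k\<bar> * \<bar>k\<bar>"
    using mult_left_mono[of 1 "\<bar>k\<bar>" "\<bar>k\<bar>"] by (cases "k = 0") auto
  thus ?thesis by (simp add: power2_eq_square flip: abs_mult)
qed

lemma psi_nth:
  assumes "k < n"
  shows "fps_nth (\<Sum>k\<in>{- int n..<int n}. fps_X ^ nat (k * (2 * k + 1))) k = fps_nth psi k"
proof -
  have "j \<in> {- int n..<int n}" if "j * (2 * j + 1) = int k" for j
    using abs_le_two_triangle[of j] that assms by auto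
  hence set: "{j \<in> {- int n..<int n}. j * (2 * j + 1) = int k} = {j. j * (2 * j + 1) = int k}"
    by blast
  have "0 \<le> j * (2 * j + 1)" for j :: int
    using abs_le_two_triangle[of j] by linarith
  thus ?thesis
    by (subst fps_nth_sum_X_power) (simp_all only: set psi_def fps_nth_Abs_fps finite_atLeastLessThan_int)
qed

lemma phi_nth:
  assumes "k \<le> n"
  shows "fps_nth (\<Sum>k\<in>{- int n..int n}. fps_X ^ nat (k\<^sup>2)) k = fps_nth phi k"
proof -
  have "j \<in> {- int n..int n}" if "j\<^sup>2 = int k" for j
    using abs_le_power2_int[of j] that assms by auto
  hence set: "{j \<in> {- int n..int n}. j\<^sup>2 = int k} = {j. j\<^sup>2 = int k}"
    by blast
  show ?thesis
    by (subst fps_nth_sum_X_power) (simp_all only: set phi_def fps_nth_Abs_fps finite_atLeastAtMost_int zero_le_power2)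
qed

text \<open>Shanks' argument: in the step from \<open>n\<close> to \<open>n + 1\<close> the right-hand sides telescope.\<close>

lemma finite_psi_identity:
  fixes X :: "int fps"
  defines "X \<equiv> fps_X"
  shows "(\<Sum>k\<in>{- int n..<int n}. X ^ nat (k * (2 * k + 1))) * (\<Prod>i<n. 1 - X ^ (2 * i + 1)) =
         (\<Sum>s<n. (\<Prod>i\<in>{s..<n}. 1 - X ^ (2 * i + 2)) * (\<Prod>i<s. 1 - X ^ (2 * i + 1)) * X ^ (s * (2 * n + 1)))"
proof (induction n)
  case (Suc n)
  define A where "A = (\<lambda>s. (\<Prod>i\<in>{s..<n}. 1 - X ^ (2 * i + 2)) * (\<Prod>i<s. 1 - X ^ (2 * i + 1)))"
  define w where "w = X ^ (2 * n + 1)"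
  \<comment> \<open>The bracket compares the summand for \<open>n + 1\<close> with
    \<open>1 - w\<close> times the summand for \<open>n\<close>, where \<open>1 - w\<close> is the
    new factor on the left-hand side.\<close>
  have partial: "(\<Sum>s<m. A s * w ^ s * ((1 - w * X) * X ^ (2 * s) - (1 - w))) = A m * (1 - X ^ (2 * m)) * w ^ m"
    if "m \<le> n" for m
    using that
  proof (induction m)
    case (Suc m)
    define B where "B = (\<Prod>i\<in>{Suc m..<n}. 1 - X ^ (2 * i + 2)) * (\<Prod>i<m. 1 - X ^ (2 * i + 1))"
    define u where "u = X ^ (2 * m)"
    have A: "A m = (1 - u * X\<^sup>2) * B" "A (Suc m) = B * (1 - u * X)"
      using Suc.prems by (simp_all add: A_def B_def u_def prod.atLeast_Suc_lessThan mult_ac power2_eq_square)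
    have u: "X ^ (2 * Suc m) = u * X\<^sup>2"
      by (simp add: u_def power2_eq_square mult_ac)
    show ?case
      using Suc by (simp add: A u flip: u_def) (simp add: algebra_simps power2_eq_square)
  qed simp
  have sq: "X ^ (2 * n + 2) = w * X" "X ^ (2 * n) * X = w"
    by (simp_all add: w_def)
  have pw: "X ^ (s * (2 * n + 1)) = w ^ s" "X ^ (s * (2 * Suc n + 1)) = w ^ s * X ^ (2 * s)" for s
  proof -
    have "s * (2 * Suc n + 1) = (2 * n + 1) * s + 2 * s"
      by (simp add: algebra_simps)
    thus "X ^ (s * (2 * Suc n + 1)) = w ^ s * X ^ (2 * s)"
      by (simp only: w_def power_add power_mult)
  qed (simp only: w_def mult.commute[of s] power_mult)
  have A_Suc: "(\<Prod>i\<in>{s..<Suc n}. 1 - X ^ (2 * i + 2)) * (\<Prod>i<s. 1 - X ^ (2 * i + 1)) = A s * (1 - w * X)" if "s \<le> n" for s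
    unfolding A_def prod.atLeastLessThan_Suc[OF that] sq by (simp only: mult_ac)
  have set: "{- int (Suc n)..<int (Suc n)} = insert (int n) (insert (- int (Suc n)) {- int n..<int n})"
    by auto
  have exps: "nat (int n * (2 * int n + 1)) = n * (2 * n + 1)"
    "nat (- int (Suc n) * (2 * (- int (Suc n)) + 1)) = (n + 1) * (2 * n + 1)"
    by (simp_all add: nat_eq_iff algebra_simps)
  have S: "(\<Sum>k\<in>{- int (Suc n)..<int (Suc n)}. X ^ nat (k * (2 * k + 1))) =
            (\<Sum>k\<in>{- int n..<int n}. X ^ nat (k * (2 * k + 1))) + w ^ n + w ^ (n + 1)"
    unfolding set by (subst sum.insert, simp, simp, subst sum.insert, simp, simp)
                     (unfold exps pw, simp only: add_ac)
  define U where "U = X ^ (2 * n)"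
  have An: "(\<Prod>i<n. 1 - X ^ (2 * i + 1)) = A n"
    by (simp add: A_def)
  have "(\<Sum>s<Suc n. (\<Prod>i\<in>{s..<Suc n}. 1 - X ^ (2 * i + 2)) * (\<Prod>i<s. 1 - X ^ (2 * i + 1)) * X ^ (s * (2 * Suc n + 1)))
        = (\<Sum>s<Suc n. A s * (1 - w * X) * (w ^ s * X ^ (2 * s)))"
    by (intro sum.cong) (simp_all only: A_Suc pw lessThan_iff less_Suc_eq_le)
  also have "\<dots> = (\<Sum>s<n. A s * w ^ s * ((1 - w * X) * X ^ (2 * s) - (1 - w))) + (\<Sum>s<n. A s * w ^ s) * (1 - w)
                 + A n * (1 - w * X) * (w ^ n * U)"
    by (simp add: sum_distrib_right U_def flip: sum.distrib) (simp add: algebra_simps)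
  also have "(\<Sum>s<n. A s * w ^ s) = (\<Sum>k\<in>{- int n..<int n}. X ^ nat (k * (2 * k + 1))) * A n"
    using Suc.IH by (simp only: pw An) (simp add: A_def)
  also have "(\<Sum>s<n. A s * w ^ s * ((1 - w * X) * X ^ (2 * s) - (1 - w))) = A n * (1 - U) * w ^ n"
    using partial[of n] by (simp add: U_def)
  also have "A n * (1 - U) * w ^ n + (\<Sum>k\<in>{- int n..<int n}. X ^ nat (k * (2 * k + 1))) * A n * (1 - w)
                 + A n * (1 - w * X) * (w ^ n * U) =
     A n * ((\<Sum>k\<in>{- int n..<int n}. X ^ nat (k * (2 * k + 1))) * (1 - w) + w ^ n * (1 - w * (U * X)))"
    by (simp add: algebra_simps)
  also have "U * X = w" by (simp add: U_def sq)
  also have "A n * ((\<Sum>k\<in>{- int n..<int n}. X ^ nat (k * (2 * k + 1))) * (1 - w) + w ^ n * (1 - w * w)) =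
     (\<Sum>k\<in>{- int (Suc n)..<int (Suc n)}. X ^ nat (k * (2 * k + 1))) * (\<Prod>i<Suc n. 1 - X ^ (2 * i + 1))"
    unfolding S prod.lessThan_Suc An w_def[symmetric] by (simp add: algebra_simps)
  finally show ?case ..
qed simp

text \<open>Only the summand \<open>s = 0\<close> of the finite identity reaches coefficient
  \<open>n\<close>; the others start at exponent \<open>2 * n + 3\<close> or later.\<close>

lemma psi_mult_euler_odd: "psi * euler_odd = dil 2 euler"
proof (rule fps_ext)
  fix n
  define S where "S = (\<Sum>k\<in>{- int (Suc n)..<int (Suc n)}. fps_X ^ nat (k * (2 * k + 1)) :: int fps)"
  have "fps_nth (psi * euler_odd) n = fps_nth (S * (\<Prod>i\<le>n. 1 - fps_X ^ (2 * i + 1))) n"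
    unfolding S_def euler_odd_def using tame_euler_odd
    by (intro fps_nth_mult_cong; subst psi_nth eprod_nth) auto
  also have "S * (\<Prod>i\<le>n. 1 - fps_X ^ (2 * i + 1)) =
      (\<Sum>s<Suc n. (\<Prod>i\<in>{s..<Suc n}. 1 - fps_X ^ (2 * i + 2)) * (\<Prod>i<s. 1 - fps_X ^ (2 * i + 1)) * fps_X ^ (s * (2 * Suc n + 1)))"
    using finite_psi_identity[of "Suc n"] by (simp only: S_def lessThan_Suc_atMost)
  also have "fps_nth \<dots> n = fps_nth (\<Prod>i\<in>{0..<Suc n}. 1 - fps_X ^ (2 * i + 2) :: int fps) n"
    unfolding fps_sum_nth by (subst sum.lessThan_Suc_shift) (simp add: fps_X_power_mult_right_nth del: power_Suc)
  also have "{0..<Suc n} = {..n}" by auto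
  also have "fps_nth (\<Prod>i\<le>n. 1 - fps_X ^ (2 * i + 2) :: int fps) n = fps_nth (dil 2 euler) n"
    by (simp add: dil_euler eprod_def)
  finally show "fps_nth (psi * euler_odd) n = fps_nth (dil 2 euler) n" .
qed

text \<open>The same telescoping for the alternating series. The summand that would belong to
  \<open>t = - 1\<close> stands apart, as it alone lacks the factor 2.\<close>

lemma finite_phi_identity:
  fixes X :: "int fps"
  defines "X \<equiv> fps_X"
  shows "alt (\<Sum>k\<in>{- int n..int n}. X ^ nat (k\<^sup>2)) * (\<Prod>i<n. 1 + X ^ (i + 1)) =
         (\<Prod>i<n. 1 - X ^ (i + 1)) +
         (\<Sum>t<n. 2 * (- 1) ^ (t + 1) * ((\<Prod>i\<in>{t + 1..<n}. 1 - X ^ (i + 1)) * (\<Prod>i<t. 1 + X ^ (i + 1))) * X ^ ((t + 1) * (n + 1)))"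
proof (induction n)
  case 0
  show ?case by (simp add: alt_simps)
next
  case (Suc n)
  define S where "S = (\<lambda>n. alt (\<Sum>k\<in>{- int n..int n}. X ^ nat (k\<^sup>2)))"
  define A where "A = (\<lambda>s. (\<Prod>i\<in>{s..<n}. 1 - X ^ (i + 1)) * (\<Prod>i<s. 1 + X ^ (i + 1)))"
  define B where "B = (\<lambda>t. (\<Prod>i\<in>{t + 1..<n}. 1 - X ^ (i + 1)) * (\<Prod>i<t. 1 + X ^ (i + 1)))"
  define w where "w = X ^ (n + 1)"
  \<comment> \<open>Here \<open>- 2 * w * A 0\<close> is the change of the separate term,
    \<open>A 0 * (1 - w)\<close> against \<open>A 0 * (1 + w)\<close>.\<close>
  have partial: "- 2 * w * A 0 +
      (\<Sum>t<m. 2 * (- 1) ^ (t + 1) * B t * w ^ (t + 1) * ((1 - w) * X ^ (t + 1) - (1 + w))) =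
        - 2 * (- 1) ^ m * w ^ (m + 1) * A m" if "m \<le> n" for m
    using that
  proof (induction m)
    case (Suc m)
    define v where "v = X ^ (m + 1)"
    have A: "A m = B m * (1 - v)" "A (Suc m) = B m * (1 + v)"
      using Suc.prems by (simp_all add: A_def B_def v_def prod.atLeast_Suc_lessThan mult_ac)
    have IH: "- 2 * w * A 0 + (\<Sum>t<m. 2 * (- 1) ^ (t + 1) * B t * w ^ (t + 1) * ((1 - w) * X ^ (t + 1) - (1 + w)))
        = - 2 * (- 1) ^ m * w ^ (m + 1) * A m"
      using Suc by simp
    show ?case
      unfolding sum.lessThan_Suc add.assoc[symmetric] IH A v_def[symmetric] by (simp add: algebra_simps)
  qed simp
  have set: "{- int (Suc n)..int (Suc n)} = insert (int (Suc n)) (insert (- int (Suc n)) {- int n..int n})"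
    by auto
  have "nat ((int (Suc n))\<^sup>2) = (n + 1) * (n + 1)" "nat ((- int (Suc n))\<^sup>2) = (n + 1) * (n + 1)"
    by (simp_all add: nat_eq_iff power2_eq_square algebra_simps)
  hence "(\<Sum>k\<in>{- int (Suc n)..int (Suc n)}. X ^ nat (k\<^sup>2)) =
           (\<Sum>k\<in>{- int n..int n}. X ^ nat (k\<^sup>2)) + 2 * X ^ ((n + 1) * (n + 1))"
    unfolding set by (subst sum.insert, simp, simp, subst sum.insert, simp, simp) simp
  moreover have "alt (X ^ ((n + 1) * (n + 1))) = (- 1) ^ (n + 1) * w ^ (n + 1)"
  proof -
    have "alt (X ^ ((n + 1) * (n + 1))) = (- 1) ^ ((n + 1) * (n + 1)) * w ^ (n + 1)"
      by (simp only: X_def w_def alt_power alt_X power_minus[of fps_X "(n + 1) * (n + 1)"] flip: power_mult)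
    also have "(- 1) ^ ((n + 1) * (n + 1)) = ((- 1) ^ (n + 1) :: int fps)"
      by (simp add: uminus_power_if)
    finally show ?thesis .
  qed
  ultimately have S: "S (Suc n) = S n + 2 * (- 1) ^ (n + 1) * w ^ (n + 1)"
    by (simp add: S_def alt_simps)
  have pw: "X ^ ((t + 1) * (n + 1)) = w ^ (t + 1)" "X ^ ((t + 1) * (Suc n + 1)) = w ^ (t + 1) * X ^ (t + 1)" for t
    unfolding w_def by (simp_all only: flip: power_mult power_add) (simp_all add: algebra_simps)
  have B_Suc: "(\<Prod>i\<in>{t + 1..<Suc n}. 1 - X ^ (i + 1)) * (\<Prod>i<t. 1 + X ^ (i + 1)) =
      (if t < n then B t * (1 - w) else A n)" if "t \<le> n" for t
    using that by (auto simp: A_def B_def w_def mult_ac)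
  have An: "(\<Prod>i<n. 1 + X ^ (i + 1)) = A n" and A0: "(\<Prod>i<n. 1 - X ^ (i + 1)) = A 0"
    by (simp_all add: A_def atLeast0LessThan)
  have IH: "S n * A n = A 0 + (\<Sum>t<n. 2 * (- 1) ^ (t + 1) * B t * w ^ (t + 1))"
    using Suc.IH by (simp only: pw An A0 S_def B_def)
  have "(\<Sum>t<Suc n. 2 * (- 1) ^ (t + 1) * ((\<Prod>i\<in>{t + 1..<Suc n}. 1 - X ^ (i + 1)) * (\<Prod>i<t. 1 + X ^ (i + 1))) * X ^ ((t + 1) * (Suc n + 1))) =
     (\<Sum>t<Suc n. 2 * (- 1) ^ (t + 1) * (if t < n then B t * (1 - w) else A n) * (w ^ (t + 1) * X ^ (t + 1)))"
    by (intro sum.cong) (simp_all only: B_Suc pw lessThan_iff less_Suc_eq_le)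
  also have "\<dots> = (\<Sum>t<n. 2 * (- 1) ^ (t + 1) * B t * w ^ (t + 1) * ((1 - w) * X ^ (t + 1) - (1 + w))) +
        (\<Sum>t<n. 2 * (- 1) ^ (t + 1) * B t * w ^ (t + 1)) * (1 + w) + 2 * (- 1) ^ (n + 1) * A n * (w ^ (n + 1) * w)"
    by (simp add: sum_distrib_right flip: sum.distrib w_def[unfolded Suc_eq_plus1[symmetric] power_Suc])
       (simp add: algebra_simps)
  finally have "(\<Prod>i<Suc n. 1 - X ^ (i + 1)) + (\<Sum>t<Suc n. 2 * (- 1) ^ (t + 1) * ((\<Prod>i\<in>{t + 1..<Suc n}. 1 - X ^ (i + 1)) * (\<Prod>i<t. 1 + X ^ (i + 1))) * X ^ ((t + 1) * (Suc n + 1))) =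
     A 0 * (1 - w) + ((\<Sum>t<n. 2 * (- 1) ^ (t + 1) * B t * w ^ (t + 1) * ((1 - w) * X ^ (t + 1) - (1 + w))) +
        (\<Sum>t<n. 2 * (- 1) ^ (t + 1) * B t * w ^ (t + 1)) * (1 + w) + 2 * (- 1) ^ (n + 1) * A n * (w ^ (n + 1) * w))"
    by (simp only: prod.lessThan_Suc A0 w_def)
  also have "\<dots> = S n * A n * (1 + w) + (- 2 * w * A 0 +
      (\<Sum>t<n. 2 * (- 1) ^ (t + 1) * B t * w ^ (t + 1) * ((1 - w) * X ^ (t + 1) - (1 + w)))) + 2 * (- 1) ^ (n + 1) * A n * (w ^ (n + 1) * w)"
    unfolding IH by (simp add: algebra_simps)
  also have "\<dots> = S (Suc n) * (A n * (1 + w))"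
    unfolding partial[OF order_refl] S by (simp add: algebra_simps)
  also have "A n * (1 + w) = (\<Prod>i<Suc n. 1 + X ^ (i + 1))"
    by (simp only: prod.lessThan_Suc An w_def)
  finally show ?case by (simp only: S_def)
qed

text \<open>Gauss' product f_1^2 / f_2. In coefficient \<open>n\<close> the sum of the finite
  identity vanishes, each summand having order at least \<open>n + 2\<close>; the product of the 1 +
  q^i is f_2 / f_1.\<close>

lemma alt_phi_mult_dil_euler: "alt phi * dil 2 euler = euler\<^sup>2"
proof -
  have tame: "tame (\<lambda>i. 1 + fps_X ^ (i + 1))"
    using X_power_dvd_one_plus[of _ _ 1] by (simp add: tame_def del: power_Suc)
  have "alt phi * eprod (\<lambda>i. 1 + fps_X ^ (i + 1)) = euler"
  proof (rule fps_ext)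
    fix n
    define S where "S = alt (\<Sum>k\<in>{- int (Suc n)..int (Suc n)}. fps_X ^ nat (k\<^sup>2))"
    have "fps_nth (alt phi * eprod (\<lambda>i. 1 + fps_X ^ (i + 1))) n = fps_nth (S * (\<Prod>i\<le>n. 1 + fps_X ^ (i + 1))) n"
      unfolding S_def using tame
      by (intro fps_nth_mult_cong; subst alt_nth eprod_nth; (subst alt_nth)?; (subst phi_nth)?) auto
    also have "S * (\<Prod>i\<le>n. 1 + fps_X ^ (i + 1)) = (\<Prod>i<Suc n. 1 - fps_X ^ (i + 1)) +
         (\<Sum>t<Suc n. 2 * (- 1) ^ (t + 1) * ((\<Prod>i\<in>{t + 1..<Suc n}. 1 - fps_X ^ (i + 1)) * (\<Prod>i<t. 1 + fps_X ^ (i + 1))) * fps_X ^ ((t + 1) * (Suc n + 1)))"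
      using finite_phi_identity[of "Suc n"] by (simp only: S_def lessThan_Suc_atMost)
    also have "fps_nth \<dots> n = fps_nth (\<Prod>i<Suc n. 1 - fps_X ^ (i + 1) :: int fps) n"
      by (simp add: fps_sum_nth fps_X_power_mult_right_nth del: power_Suc prod.lessThan_Suc sum.lessThan_Suc)
    also have "\<dots> = fps_nth euler n"
      by (simp add: lessThan_Suc_atMost euler_def eprod_def)
    finally show "fps_nth (alt phi * eprod (\<lambda>i. 1 + fps_X ^ (i + 1))) n = fps_nth euler n" .
  qed
  moreover have "eprod (\<lambda>i. 1 + fps_X ^ (i + 1)) * euler = dil 2 euler"
  proof -
    have "(1 + fps_X ^ (i + 1)) * (1 - fps_X ^ Suc i) = (1 - fps_X ^ (2 * Suc i) :: int fps)" for i
      by (simp add: algebra_simps mult_2 flip: power_add)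
    hence "eprod (\<lambda>i. 1 + fps_X ^ (i + 1)) * euler = eprod (\<lambda>i. 1 - fps_X ^ (2 * Suc i))"
      using eprod_mult[OF tame tame_euler[of 1]] by (simp only: euler_def mult_1 zero_less_one simp_thms)
    thus ?thesis by (simp only: dil_euler zero_less_numeral)
  qed
  ultimately show ?thesis
    by (metis mult.assoc power2_eq_square)
qed

lemma psi_mult_euler: "psi * euler = (dil 2 euler)\<^sup>2"
  using psi_mult_euler_odd euler_eq_odd_mult by (metis mult.assoc power2_eq_square)

section \<open>Representations by theta series\<close>

text \<open>An infinite fibre would count as 0; the bound \<open>\<bar>k\<bar> \<le> e k\<close>
  assumed below keeps fibres finite.\<close>

definition theta :: "(int \<Rightarrow> int) \<Rightarrow> int fps" where
  "theta e = Abs_fps (\<lambda>n. int (card {k. e k = int n}))"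

lemma psi_theta: "psi = theta (\<lambda>k. k * (2 * k + 1))"
  and phi_theta: "phi = theta (\<lambda>k. k\<^sup>2)"
  by (simp_all add: psi_def phi_def theta_def)

lemma dil_theta:
  assumes "c > 0"
  shows "dil c (theta e) = theta (\<lambda>k. int c * e k)"
proof (rule fps_ext)
  fix n
  have "{k. int c * e k = int n} = (if c dvd n then {k. e k = int (n div c)} else {})"
  proof (cases "c dvd n")
    case True
    then obtain m where n: "n = c * m" ..
    have "int c * e k = int c * int m \<longleftrightarrow> e k = int m" for k
      using assms by simp
    thus ?thesis using assms by (simp add: n)
  next
    case False
    have "int c * e k \<noteq> int n" for k
      using False by (metis dvd_triv_left int_dvd_int_iff)
    thus ?thesis using False by simp
  qed
  thus "fps_nth (dil c (theta e)) n = fps_nth (theta (\<lambda>k. int c * e k)) n"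
    by (simp add: dil_nth theta_def)
qed

lemma finite_theta_fibre:
  assumes "\<And>k. \<bar>k\<bar> \<le> e k"
  shows "finite {k :: int. e k = int n}"
proof (rule finite_subset)
  show "{k. e k = int n} \<subseteq> {- int n..int n}"
  proof
    fix k assume "k \<in> {k. e k = int n}"
    thus "k \<in> {- int n..int n}" using assms[of k] by auto
  qed
qed simp

lemma theta_mult_nth:
  assumes e: "\<And>k. \<bar>k\<bar> \<le> e k" and f: "\<And>k. \<bar>k\<bar> \<le> f k"
  shows "fps_nth (theta e * theta f) n = int (card {(k, l). e k + f l = int n})"
proof -
  have "{(k, l). e k + f l = int n} = (\<Union>i\<in>{0..n}. {k. e k = int i} \<times> {l. f l = int (n - i)})"
  proof safe
    fix k l assume eq: "e k + f l = int n"
    have "e k \<ge> 0" "f l \<ge> 0"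
      using e[of k] f[of l] by linarith+
    with eq show "(k, l) \<in> (\<Union>i\<in>{0..n}. {k. e k = int i} \<times> {l. f l = int (n - i)})"
      by (intro UN_I[of "nat (e k)"]) (auto simp: nat_le_iff)
  qed auto
  also have "card \<dots> = (\<Sum>i\<in>{0..n}. card ({k. e k = int i} \<times> {l. f l = int (n - i)}))"
    by (intro card_UN_disjoint ballI finite_cartesian_product finite_theta_fibre e f) auto
  finally show ?thesis
    by (simp add: fps_mult_nth theta_def card_cartesian_product)
qed

section \<open>The binary form behind psi(q) psi(q^7)\<close>

definition psi_psi7 :: "int fps" where
  "psi_psi7 = psi * dil 7 psi"

lemma psi_psi7_nth:
  "fps_nth psi_psi7 n = int (card {(k :: int, l :: int). k * (2 * k + 1) + 7 * (l * (2 * l + 1)) = int n})"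
proof -
  have "\<bar>k\<bar> \<le> int 7 * (k * (2 * k + 1))" for k :: int
    using abs_le_two_triangle[of k] by linarith
  thus ?thesis
    unfolding psi_psi7_def psi_theta using abs_le_two_triangle
    by (subst dil_theta, simp, subst theta_mult_nth) simp_all
qed

text \<open>With a = 4k + 1 and b = 4l + 1, eight times the exponent plus 8 is a^2 + 7 b^2, so
  passing from exponent n to 2n + 1 doubles the norm of a + b sqrt(-7). Multiplication by (1 +
  sqrt(-7)) / 2, of norm 2, gives the bijection.\<close>

lemma odd_part_psi_psi7: "odd_part psi_psi7 = psi_psi7"
proof (rule fps_ext)
  fix n
  define Q :: "int \<Rightarrow> int \<Rightarrow> int" where "Q = (\<lambda>k l. k * (2 * k + 1) + 7 * (l * (2 * l + 1)))"
  \<comment> \<open>The product has components (a - 7b) / 2 and (a + b) / 2; the second case takes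
    its negative, so that both are again 1 modulo 4.\<close>
  define g :: "int \<times> int \<Rightarrow> int \<times> int" where
    "g = (\<lambda>(k, l). if even (k + l) then ((k - 7 * l - 2) div 2, (k + l) div 2)
                    else ((7 * l - k + 1) div 2, - ((k + l + 1) div 2)))"
  \<comment> \<open>Multiplication by the conjugate (1 - sqrt(-7)) / 2, halved, with the sign chosen
    likewise.\<close>
  define h :: "int \<times> int \<Rightarrow> int \<times> int" where
    "h = (\<lambda>(k, l). if (l - k) mod 4 = 1 then ((k + 7 * l + 1) div 4, (l - k - 1) div 4)
                    else (- ((k + 7 * l + 3) div 4), - ((l - k + 1) div 4)))"
  have g: "\<exists>k' l'. g (k, l) = (k', l') \<and> Q k' l' = 2 * Q k l + 1 \<and> h (k', l') = (k, l)" for k l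
  proof (cases "even (k + l)")
    case True
    then obtain m where "k + l = 2 * m" ..
    hence l: "l = 2 * m - k" by simp
    have "(k - 7 * l - 2) div 2 = 4 * k - 7 * m - 1" "(k + l) div 2 = m"
      unfolding l by simp_all
    hence "g (k, l) = (4 * k - 7 * m - 1, m)"
      using True by (simp add: g_def)
    moreover have "Q (4 * k - 7 * m - 1) m = 2 * Q k l + 1"
      by (simp add: Q_def l algebra_simps)
    moreover have "h (4 * k - 7 * m - 1, m) = (k, l)"
    proof -
      have "(m - (4 * k - 7 * m - 1)) mod 4 = 1" by presburger
      thus ?thesis by (simp add: h_def l)
    qed
    ultimately show ?thesis by blast
  next
    case False
    then obtain m where "k + l = 2 * m + 1" by (elim oddE)
    hence l: "l = 2 * m + 1 - k" by simp
    have "(7 * l - k + 1) div 2 = 7 * m + 4 - 4 * k" "(k + l + 1) div 2 = m + 1"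
      unfolding l by simp_all
    hence "g (k, l) = (7 * m + 4 - 4 * k, - (m + 1))"
      using False by (simp add: g_def)
    moreover have "Q (7 * m + 4 - 4 * k) (- (m + 1)) = 2 * Q k l + 1"
      by (simp add: Q_def l algebra_simps)
    moreover have "h (7 * m + 4 - 4 * k, - (m + 1)) = (k, l)"
    proof -
      have "(- (m + 1) - (7 * m + 4 - 4 * k)) mod 4 \<noteq> 1" by presburger
      thus ?thesis by (simp add: h_def l)
    qed
    ultimately show ?thesis by blast
  qed
  have h: "\<exists>k' l'. h (k, l) = (k', l') \<and> 2 * Q k' l' + 1 = Q k l \<and> g (k', l') = (k, l)"
    if "odd (Q k l)" for k l
  proof -
    have "odd (k + l)"
      using that unfolding Q_def by simp
    hence "(l - k) mod 4 = 1 \<or> (l - k) mod 4 = 3" by presburger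
    thus ?thesis
    proof
      assume *: "(l - k) mod 4 = 1"
      then obtain m where "l - k = 4 * m + 1"
        by (metis mult_div_mod_eq)
      hence l: "l = k + 4 * m + 1" by simp
      have "(k + 7 * l + 1) div 4 = 2 * k + 7 * m + 2" "(l - k - 1) div 4 = m"
        unfolding l by simp_all
      hence "h (k, l) = (2 * k + 7 * m + 2, m)"
        using * by (simp add: h_def)
      moreover have "2 * Q (2 * k + 7 * m + 2) m + 1 = Q k l"
        by (simp add: Q_def l algebra_simps)
      moreover have "g (2 * k + 7 * m + 2, m) = (k, l)"
        by (simp add: g_def l)
      ultimately show ?thesis by blast
    next
      assume *: "(l - k) mod 4 = 3"
      then obtain m where "l - k = 4 * m + 3"
        by (metis mult_div_mod_eq)
      hence l: "l = k + 4 * m + 3" by simp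
      have "(k + 7 * l + 3) div 4 = 2 * k + 7 * m + 6" "(l - k + 1) div 4 = m + 1"
        unfolding l by simp_all
      hence "h (k, l) = (- (2 * k + 7 * m + 6), - (m + 1))"
        using * by (simp add: h_def)
      moreover have "2 * Q (- (2 * k + 7 * m + 6)) (- (m + 1)) + 1 = Q k l"
        by (simp add: Q_def l algebra_simps)
      moreover have "g (- (2 * k + 7 * m + 6), - (m + 1)) = (k, l)"
        by (simp add: g_def l)
      ultimately show ?thesis by blast
    qed
  qed
  have "bij_betw g {(k, l). Q k l = int n} {(k, l). Q k l = int (2 * n + 1)}"
  proof (rule bij_betwI)
    show "g \<in> {(k, l). Q k l = int n} \<rightarrow> {(k, l). Q k l = int (2 * n + 1)}"
    proof
      fix x assume "x \<in> {(k, l). Q k l = int n}"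
      thus "g x \<in> {(k, l). Q k l = int (2 * n + 1)}"
        using g[of "fst x" "snd x"] by (auto simp: case_prod_unfold)
    qed
    show "h \<in> {(k, l). Q k l = int (2 * n + 1)} \<rightarrow> {(k, l). Q k l = int n}"
    proof
      fix x assume "x \<in> {(k, l). Q k l = int (2 * n + 1)}"
      thus "h x \<in> {(k, l). Q k l = int n}"
        using h[of "fst x" "snd x"] by (auto simp: case_prod_unfold)
    qed
  next
    fix x assume "x \<in> {(k, l). Q k l = int n}"
    show "h (g x) = x" using g by (cases x) metis
  next
    fix y assume "y \<in> {(k, l). Q k l = int (2 * n + 1)}"
    thus "g (h y) = y" using h[of "fst y" "snd y"] by (auto simp: case_prod_unfold)
  qed
  hence "card {(k, l). Q k l = int n} = card {(k, l). Q k l = int (2 * n + 1)}"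
    by (rule bij_betw_same_card)
  thus "fps_nth (odd_part psi_psi7) n = fps_nth psi_psi7 n"
    unfolding odd_part_def fps_nth_Abs_fps psi_psi7_nth Q_def by simp
qed

lemma psi_psi7_diff_alt: "psi_psi7 - alt psi_psi7 = 2 * fps_X * dil 2 psi_psi7"
  using odd_part_doubled[of psi_psi7] by (simp add: odd_part_psi_psi7 mult.assoc)

text \<open>An even square is 4 j^2. Every odd integer is 4j + 1 or -(4j + 1) for exactly one j, and
  its square is 8 j (2j + 1) + 1.\<close>

lemma phi_dissection: "phi = dil 4 phi + 2 * fps_X * dil 8 psi"
proof (rule fps_ext)
  fix n
  let ?A = "{j :: int. 4 * j\<^sup>2 = int n}" and ?B = "{j :: int. 8 * (j * (2 * j + 1)) + 1 = int n}"
  have eq: "{k :: int. k\<^sup>2 = int n} = (\<lambda>j. 2 * j) ` ?A \<union> ((\<lambda>j. 4 * j + 1) ` ?B \<union> (\<lambda>j. - 4 * j - 1) ` ?B)"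
  proof (intro subset_antisym subsetI)
    fix k :: int assume "k \<in> {k. k\<^sup>2 = int n}"
    hence k: "k\<^sup>2 = int n" by simp
    have "even k \<or> k mod 4 = 1 \<or> (- k) mod 4 = 1" by presburger
    thus "k \<in> (\<lambda>j. 2 * j) ` ?A \<union> ((\<lambda>j. 4 * j + 1) ` ?B \<union> (\<lambda>j. - 4 * j - 1) ` ?B)"
    proof (elim disjE)
      assume "even k"
      then obtain j where "k = 2 * j" ..
      with k show ?thesis by (auto simp: power_mult_distrib)
    next
      assume "k mod 4 = 1"
      then obtain j where j: "k = 4 * j + 1" by (metis mult_div_mod_eq)
      have "j \<in> ?B"
        using k unfolding j by (simp add: power2_eq_square algebra_simps)
      thus ?thesis unfolding j by blast
    next
      assume "(- k) mod 4 = 1"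
      then obtain j where "- k = 4 * j + 1" by (metis mult_div_mod_eq)
      hence j: "k = - 4 * j - 1" by simp
      have "j \<in> ?B"
        using k unfolding j by (simp add: power2_eq_square algebra_simps)
      thus ?thesis unfolding j by blast
    qed
  qed (auto simp: power2_eq_square algebra_simps)
  have "\<bar>j\<bar> \<le> 4 * j\<^sup>2" for j :: int
    using abs_le_power2_int[of j] zero_le_power2[of j] by linarith
  hence fA: "finite ?A" by (rule finite_theta_fibre)
  have "\<bar>j\<bar> \<le> 8 * (j * (2 * j + 1)) + 1" for j :: int
    using abs_le_two_triangle[of j] by linarith
  hence fB: "finite ?B" by (rule finite_theta_fibre)
  have d1: "(\<lambda>j :: int. 2 * j) ` ?A \<inter> ((\<lambda>j. 4 * j + 1) ` ?B \<union> (\<lambda>j. - 4 * j - 1) ` ?B) = {}"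
    by (auto, presburger+)
  have d2: "(\<lambda>j :: int. 4 * j + 1) ` ?B \<inter> (\<lambda>j. - 4 * j - 1) ` ?B = {}"
    by (auto, presburger+)
  have "card {k :: int. k\<^sup>2 = int n} = card ?A + 2 * card ?B"
    unfolding eq using fA fB d1 d2
    by (subst card_Un_disjoint, simp, simp, simp, subst card_Un_disjoint)
       (simp_all add: card_image inj_on_def)
  moreover have "fps_nth (fps_X * dil 8 psi) n = int (card ?B)"
  proof (cases n)
    case 0
    have "8 * (j * (2 * j + 1)) + 1 \<noteq> 0" for j :: int by presburger
    thus ?thesis using 0 by simp
  next
    case (Suc m)
    thus ?thesis by (simp add: psi_theta dil_theta) (simp add: theta_def)
  qed
  moreover have "fps_nth (dil 4 phi) n = int (card ?A)"
    by (simp add: phi_theta dil_theta) (simp add: theta_def)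
  ultimately have "fps_nth phi n = fps_nth (dil 4 phi) n + 2 * fps_nth (fps_X * dil 8 psi) n"
    by (simp add: phi_def)
  also have "\<dots> = fps_nth (dil 4 phi + 2 * (fps_X * dil 8 psi)) n"
    by (simp only: fps_add_nth mult_2)
  finally show "fps_nth phi n = fps_nth (dil 4 phi + 2 * fps_X * dil 8 psi) n"
    by (simp only: mult.assoc)
qed

section \<open>Theta function identities\<close>

lemma dil_nth_0 [simp]: "fps_nth (dil c F) 0 = fps_nth F 0"
  and alt_nth_0 [simp]: "fps_nth (alt F) 0 = fps_nth F 0"
  by (simp_all add: dil_nth alt_nth)

lemma phi_nth_0 [simp]: "fps_nth phi 0 = 1"
  by (simp add: phi_def)

lemma psi_nth_0 [simp]: "fps_nth psi 0 = 1"
proof -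
  have "2 * k + 1 \<noteq> 0" for k :: int by presburger
  hence "{k :: int. k * (2 * k + 1) = 0} = {0}" by auto
  thus ?thesis by (simp add: psi_def)
qed

declare euler_nth_0 [simp]

lemma fps_nth_0_imp_nonzero: "fps_nth F 0 = 1 \<Longrightarrow> F \<noteq> (0 :: int fps)"
  by auto

lemma dil_euler_nonzero [simp]: "dil c euler \<noteq> 0" "euler \<noteq> 0"
  by (auto intro!: fps_nth_0_imp_nonzero)

text \<open>Product forms of theta series and their images under q -> -q and q -> q^2, cleared of
  denominators to serve as hypotheses of \<open>algebra\<close>.\<close>

lemma euler_products:
  shows "phi * dil 2 euler = (alt euler)\<^sup>2" "psi * euler = (dil 2 euler)\<^sup>2"
    "dil 2 psi * dil 2 euler = (dil 4 euler)\<^sup>2" "alt euler * euler * dil 4 euler = dil 2 euler ^ 3"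
    "alt phi * dil 2 euler = euler\<^sup>2" "dil 2 (alt phi) * dil 4 euler = (dil 2 euler)\<^sup>2"
    "alt psi * alt euler = (dil 2 euler)\<^sup>2"
proof -
  have "alt (alt phi * dil 2 euler) = alt (euler\<^sup>2)"
    by (simp only: alt_phi_mult_dil_euler)
  thus "phi * dil 2 euler = (alt euler)\<^sup>2"
    by (simp add: alt_simps alt_dil_even)
  have "dil 2 (alt phi * dil 2 euler) = dil 2 (euler\<^sup>2)"
    by (simp only: alt_phi_mult_dil_euler)
  thus "dil 2 (alt phi) * dil 4 euler = (dil 2 euler)\<^sup>2"
    by (simp add: dil_simps)
  have "dil 2 (psi * euler) = dil 2 ((dil 2 euler)\<^sup>2)"
    by (simp only: psi_mult_euler)
  thus "dil 2 psi * dil 2 euler = (dil 4 euler)\<^sup>2"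
    by (simp add: dil_simps)
  have "alt (psi * euler) = alt ((dil 2 euler)\<^sup>2)"
    by (simp only: psi_mult_euler)
  thus "alt psi * alt euler = (dil 2 euler)\<^sup>2"
    by (simp add: alt_simps alt_dil_even)
qed (simp_all add: psi_mult_euler alt_euler alt_phi_mult_dil_euler)

text \<open>Multiplied by a suitable nonzero Euler product, both sides agree by the product forms;
  the factor is then cancelled. The next three lemmas follow the same scheme.\<close>

lemma phi_mult_dil_psi: "phi * dil 2 psi = psi\<^sup>2"
proof -
  have "(dil 2 euler * euler)\<^sup>2 * (phi * dil 2 psi) = (dil 2 euler * euler)\<^sup>2 * psi\<^sup>2"
    using euler_products(1-4) by algebra
  thus ?thesis by simp
qed

lemma phi_mult_alt_phi: "phi * alt phi = (dil 2 (alt phi))\<^sup>2"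
proof -
  have "(dil 2 euler * dil 4 euler)\<^sup>2 * (phi * alt phi) = (dil 2 euler * dil 4 euler)\<^sup>2 * (dil 2 (alt phi))\<^sup>2"
    using euler_products(1,4,5,6) by algebra
  thus ?thesis by simp
qed

lemma alt_psi_euler: "alt psi * dil 2 euler = euler * dil 4 euler"
proof -
  have "alt euler * euler * dil 4 euler * (alt psi * dil 2 euler) = alt euler * euler * dil 4 euler * (euler * dil 4 euler)"
    using euler_products(4,7) by algebra
  moreover have "alt euler * euler * dil 4 euler \<noteq> 0"
    by (auto intro!: fps_nth_0_imp_nonzero)
  ultimately show ?thesis by simp
qed

lemma psi_alt_psi_dil_psi: "psi * alt psi * dil 4 psi = dil 2 psi * (dil 2 (alt psi))\<^sup>2"
proof -
  have 1: "dil 2 (alt psi) * dil 4 euler = dil 2 euler * dil 8 euler"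
  proof -
    have "dil 2 (alt psi * dil 2 euler) = dil 2 (euler * dil 4 euler)"
      by (simp only: alt_psi_euler)
    thus ?thesis by (simp add: dil_simps)
  qed
  have 2: "dil 4 psi * dil 4 euler = (dil 8 euler)\<^sup>2"
  proof -
    have "dil 4 (psi * euler) = dil 4 ((dil 2 euler)\<^sup>2)"
      by (simp only: psi_mult_euler)
    thus ?thesis by (simp add: dil_simps)
  qed
  have "euler * dil 2 euler * (dil 4 euler)\<^sup>2 * (psi * alt psi * dil 4 psi) =
        euler * dil 2 euler * (dil 4 euler)\<^sup>2 * (dil 2 psi * (dil 2 (alt psi))\<^sup>2)"
    using 1 2 euler_products(2,3) alt_psi_euler by algebra
  thus ?thesis by simp
qed

text \<open>The dissection of \<open>phi\<close>, multiplied by its image under q -> -q, involves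
  q^2 only. Read in q it gives phi(-q)^2 = phi(q^2)^2 - 4 q psi(q^4)^2, and phi(q)^2 with the
  opposite sign; the difference of the squares of both is the claim.\<close>

lemma jacobi_quartic: "phi ^ 4 - alt phi ^ 4 = 16 * fps_X * dil 2 psi ^ 4"
proof -
  have alt: "alt phi = dil 4 phi - 2 * fps_X * dil 8 psi"
    by (subst phi_dissection) (simp add: alt_simps alt_dil_even)
  have sq: "(dil 4 phi)\<^sup>2 - 4 * fps_X\<^sup>2 * (dil 8 psi)\<^sup>2 = (dil 2 (alt phi))\<^sup>2"
  proof -
    have "phi * alt phi = (dil 4 phi)\<^sup>2 - 4 * fps_X\<^sup>2 * (dil 8 psi)\<^sup>2"
      unfolding alt by (subst phi_dissection) (simp add: power2_eq_square algebra_simps)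
    thus ?thesis by (simp add: phi_mult_alt_phi)
  qed
  hence "dil 2 ((dil 2 phi)\<^sup>2 - 4 * fps_X * (dil 4 psi)\<^sup>2) = dil 2 ((alt phi)\<^sup>2)"
    by (simp add: dil_simps)
  hence sq_alt: "(alt phi)\<^sup>2 = (dil 2 phi)\<^sup>2 - 4 * fps_X * (dil 4 psi)\<^sup>2"
    by (simp add: dil_inject)
  hence "alt ((alt phi)\<^sup>2) = alt ((dil 2 phi)\<^sup>2 - 4 * fps_X * (dil 4 psi)\<^sup>2)"
    by (rule arg_cong)
  hence sq_phi: "phi\<^sup>2 = (dil 2 phi)\<^sup>2 + 4 * fps_X * (dil 4 psi)\<^sup>2"
    by (simp add: alt_simps alt_dil_even)
  have "dil 2 (phi * dil 2 psi) = dil 2 (psi\<^sup>2)"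
    by (simp only: phi_mult_dil_psi)
  hence "dil 2 phi * dil 4 psi = (dil 2 psi)\<^sup>2"
    by (simp add: dil_simps)
  with sq_alt sq_phi show ?thesis by algebra
qed

section \<open>The degree 7 modular equation\<close>

definition unit_inverse :: "int fps \<Rightarrow> int fps" where
  "unit_inverse F = fps_right_inverse F 1"

lemma mult_unit_inverse: "fps_nth F 0 = 1 \<Longrightarrow> F * unit_inverse F = 1"
  unfolding unit_inverse_def by (rule fps_right_inverse) simp

lemma unit_inverse_nth_0 [simp]: "fps_nth (unit_inverse F) 0 = 1"
  by (simp add: unit_inverse_def)

lemma psi_psi7_nth_0 [simp]: "fps_nth psi_psi7 0 = 1"
  by (simp add: psi_psi7_def)

lemma psi_psi7_nonzero [simp]: "psi_psi7 \<noteq> 0" "alt psi_psi7 \<noteq> 0" "dil c psi_psi7 \<noteq> 0" "dil c (alt psi_psi7) \<noteq> 0"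
  by (auto intro!: fps_nth_0_imp_nonzero)

text \<open>Written with theta series because its quadratic equation comes from identities for
  \<open>psi_psi7\<close>; \<open>rho_euler7\<close> recovers the eta quotient.\<close>

definition rho :: "int fps" where
  "rho = fps_X * dil 2 psi_psi7 * unit_inverse (alt psi_psi7)"

text \<open>By \<open>dil_xi_euler7\<close> this is q (f_2 f_14 / (f_1 f_7))^3.\<close>

definition xi :: "int fps" where
  "xi = rho + 2 * rho\<^sup>2"

lemma rho_mult: "rho * alt psi_psi7 = fps_X * dil 2 psi_psi7"
  using mult_unit_inverse[of "alt psi_psi7"] by (simp add: rho_def mult.assoc mult.commute[of "unit_inverse _"])

lemma rho_nth_0 [simp]: "fps_nth rho 0 = 0"
  by (simp add: rho_def mult.assoc)

lemma xi_nth_0 [simp]: "fps_nth xi 0 = 0"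
  by (simp add: xi_def power2_eq_square)

lemma one_plus_rho_mult: "(1 + 2 * rho) * alt psi_psi7 = psi_psi7"
  using rho_mult psi_psi7_diff_alt by algebra

lemma psi_psi7_alt_dil:
  "psi_psi7 * alt psi_psi7 * dil 4 psi_psi7 = dil 2 psi_psi7 * (dil 2 (alt psi_psi7))\<^sup>2"
proof -
  have "dil 7 (psi * alt psi * dil 4 psi) = dil 7 (dil 2 psi * (dil 2 (alt psi))\<^sup>2)"
    by (simp only: psi_alt_psi_dil_psi)
  hence "dil 7 psi * dil 7 (alt psi) * dil 28 psi = dil 14 psi * (dil 14 (alt psi))\<^sup>2"
    by (simp add: dil_simps)
  thus ?thesis
    using psi_alt_psi_dil_psi
    by (simp add: psi_psi7_def alt_simps alt_dil_odd dil_simps) algebra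
qed

text \<open>The quadratic equation of \<open>rho\<close> over the series in q^2. With P for
  \<open>psi_psi7\<close>, rho^2 / (1 + 2 rho) is q^2 P(q^2)^2 / (P(q) P(-q)), which
  \<open>psi_psi7_alt_dil\<close> turns into an expression in \<open>dil 2 rho\<close>.\<close>

lemma rho_square: "rho\<^sup>2 = dil 2 xi * (1 + 2 * rho)"
proof -
  have "dil 2 (rho * alt psi_psi7) = dil 2 (fps_X * dil 2 psi_psi7)"
    by (simp only: rho_mult)
  hence 1: "dil 2 rho * dil 2 (alt psi_psi7) = fps_X\<^sup>2 * dil 4 psi_psi7"
    by (simp add: dil_simps)
  have "dil 2 ((1 + 2 * rho) * alt psi_psi7) = dil 2 psi_psi7"
    by (simp only: one_plus_rho_mult)
  hence 2: "(1 + 2 * dil 2 rho) * dil 2 (alt psi_psi7) = dil 2 psi_psi7"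
    by (simp add: dil_simps)
  have xi: "dil 2 xi = dil 2 rho + 2 * (dil 2 rho)\<^sup>2"
    by (simp add: xi_def dil_simps)
  have "(alt psi_psi7 * dil 2 (alt psi_psi7))\<^sup>2 * rho\<^sup>2 =
        (alt psi_psi7 * dil 2 (alt psi_psi7))\<^sup>2 * (dil 2 xi * (1 + 2 * rho))"
    using 1 2 xi psi_psi7_alt_dil rho_mult one_plus_rho_mult by algebra
  thus ?thesis by simp
qed

lemma dil_xi_mult: "dil 2 xi * psi_psi7 * alt psi_psi7 = fps_X\<^sup>2 * (dil 2 psi_psi7)\<^sup>2"
  using rho_square rho_mult one_plus_rho_mult by algebra

text \<open>The other root of the quadratic equation: q -> -q fixes its coefficients, and the roots
  add up to \<open>2 * dil 2 xi\<close>.\<close>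

lemma alt_rho: "alt rho = 2 * dil 2 xi - rho"
proof -
  have "alt (rho * alt psi_psi7) = alt (fps_X * dil 2 psi_psi7)"
    by (simp only: rho_mult)
  hence "alt rho * psi_psi7 = - fps_X * dil 2 psi_psi7"
    by (simp add: alt_simps alt_dil_even)
  hence "psi_psi7 * alt psi_psi7 * alt rho = psi_psi7 * alt psi_psi7 * (2 * dil 2 xi - rho)"
    using dil_xi_mult rho_mult psi_psi7_diff_alt by algebra
  thus ?thesis by simp
qed

text \<open>Half the difference of the two roots, hence an odd series; with 1 it serves as a basis
  over the series in q^2.\<close>

definition delta :: "int fps" where
  "delta = rho - dil 2 xi"

lemma rho_eq_delta: "rho = dil 2 xi + delta"
  by (simp add: delta_def)

lemma alt_delta: "alt delta = - delta"
  by (simp add: delta_def alt_simps alt_dil_even alt_rho)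

lemma delta_square: "delta\<^sup>2 = dil 2 xi * (1 + dil 2 xi)"
  using rho_square by (simp add: delta_def power2_eq_square algebra_simps)

section \<open>The quotients \<open>tau\<close> and \<open>kappa\<close>, and the trace of
  \<open>kappa\<close>\<close>

definition tau :: "int fps" where
  "tau = dil 7 (alt phi) * unit_inverse (alt phi)"

definition kappa :: "int fps" where
  "kappa = tau * unit_inverse (dil 2 tau)"

text \<open>This turns out to be the even part of \<open>kappa\<close>, see
  \<open>even_part_kappa\<close>. Its second factor is a series in q^2 with square
  \<open>1 + 8 * dil 2 xi\<close>.\<close>

definition eps :: "int fps" where
  "eps = (1 + 2 * rho) * (1 + 4 * dil 2 rho)"

lemma tau_nth_0 [simp]: "fps_nth tau 0 = 1"
  by (simp add: tau_def)

lemma kappa_nth_0 [simp]: "fps_nth kappa 0 = 1"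
  by (simp add: kappa_def)

lemma eps_nth_0 [simp]: "fps_nth eps 0 = 1"
  by (simp add: eps_def)

lemma tau_mult: "tau * alt phi = dil 7 (alt phi)"
  using mult_unit_inverse[of "alt phi"] by (simp add: tau_def mult.assoc mult.commute[of "unit_inverse _"])

lemma kappa_mult: "kappa * dil 2 tau = tau"
  using mult_unit_inverse[of "dil 2 tau"] by (simp add: kappa_def mult.assoc mult.commute[of "unit_inverse _"])

lemma alt_tau_mult: "alt tau * phi = dil 7 phi"
proof -
  have "alt (tau * alt phi) = alt (dil 7 (alt phi))"
    by (simp only: tau_mult)
  thus ?thesis by (simp add: alt_simps alt_dil_odd)
qed

lemma alt_kappa_mult: "alt kappa * dil 2 tau = alt tau"
proof -
  have "alt (kappa * dil 2 tau) = alt tau"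
    by (simp only: kappa_mult)
  thus ?thesis by (simp add: alt_simps alt_dil_even)
qed

text \<open>From phi(q) phi(-q) = phi(-q^2)^2 and its dilation by 7 follows tau(q) tau(-q) =
  tau(q^2)^2.\<close>

lemma kappa_mult_alt_kappa: "kappa * alt kappa = 1"
proof -
  have "dil 7 (phi * alt phi) = dil 7 ((dil 2 (alt phi))\<^sup>2)"
    by (simp only: phi_mult_alt_phi)
  hence 7: "dil 7 phi * dil 7 (alt phi) = (dil 14 (alt phi))\<^sup>2"
    by (simp add: dil_simps)
  have "dil 2 (tau * alt phi) = dil 2 (dil 7 (alt phi))"
    by (simp only: tau_mult)
  hence "dil 2 tau * dil 2 (alt phi) = dil 14 (alt phi)"
    by (simp add: dil_simps)
  hence 2: "(dil 2 tau)\<^sup>2 * (dil 2 (alt phi))\<^sup>2 = (dil 14 (alt phi))\<^sup>2"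
    by (simp flip: power_mult_distrib)
  have "(dil 2 tau)\<^sup>2 * (kappa * alt kappa) = (kappa * dil 2 tau) * (alt kappa * dil 2 tau)"
    by (simp add: power2_eq_square mult_ac)
  also have "\<dots> = tau * alt tau"
    by (simp only: kappa_mult alt_kappa_mult)
  finally have "(dil 2 tau)\<^sup>2 * (kappa * alt kappa) = tau * alt tau" .
  moreover have "tau * alt tau * (dil 2 (alt phi))\<^sup>2 = (alt tau * phi) * (tau * alt phi)"
    by (simp add: phi_mult_alt_phi[symmetric] mult_ac)
  hence "tau * alt tau * (dil 2 (alt phi))\<^sup>2 = (dil 14 (alt phi))\<^sup>2"
    by (simp only: tau_mult alt_tau_mult 7)
  ultimately have "(dil 2 tau)\<^sup>2 * (dil 2 (alt phi))\<^sup>2 * (kappa * alt kappa) = (dil 2 tau)\<^sup>2 * (dil 2 (alt phi))\<^sup>2 * 1"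
    using 2 by algebra
  moreover have "dil 2 tau \<noteq> 0" "dil 2 (alt phi) \<noteq> 0"
    by (auto intro!: fps_nth_0_imp_nonzero)
  ultimately show ?thesis by simp
qed

lemma eps_square: "eps\<^sup>2 = (1 + 2 * rho) * (1 + 2 * rho + 8 * rho\<^sup>2)"
proof -
  have "dil 2 xi = dil 2 rho + 2 * (dil 2 rho)\<^sup>2"
    by (simp add: xi_def dil_simps)
  thus ?thesis using rho_square unfolding eps_def by algebra
qed

text \<open>The sign of each square root is read off the constant coefficient.\<close>

lemma kappa_trace: "kappa + alt kappa = 2 * dil 2 eps"
proof -
  define P P' C Y where defs: "P = psi_psi7" "P' = alt psi_psi7" "C = dil 2 psi_psi7" "Y = 1 + 4 * dil 2 rho"
  define p m p7 m7 where defs': "p = phi" "m = alt phi" "p7 = dil 7 phi" "m7 = dil 7 (alt phi)"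
  define r4 where "r4 = kappa ^ 4 + alt kappa ^ 4"
  have diff: "P - P' = 2 * fps_X * C"
    using psi_psi7_diff_alt by (simp add: defs)
  have "dil 7 (phi ^ 4 - alt phi ^ 4) = dil 7 (16 * fps_X * dil 2 psi ^ 4)"
    by (simp only: jacobi_quartic)
  hence "p7 ^ 4 - m7 ^ 4 = 16 * fps_X ^ 7 * dil 14 psi ^ 4"
    by (simp add: defs' dil_simps)
  hence "(p ^ 4 - m ^ 4) * (p7 ^ 4 - m7 ^ 4) = 256 * fps_X ^ 8 * (dil 2 psi * dil 14 psi) ^ 4"
    using jacobi_quartic unfolding defs' by algebra
  hence quartic: "(p ^ 4 - m ^ 4) * (p7 ^ 4 - m7 ^ 4) = 256 * fps_X ^ 8 * C ^ 4"
    by (simp add: defs psi_psi7_def dil_simps)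
  have "dil 7 (phi * dil 2 psi) = dil 7 (psi\<^sup>2)"
    by (simp only: phi_mult_dil_psi)
  hence "p7 * dil 14 psi = (dil 7 psi)\<^sup>2"
    by (simp add: defs' dil_simps)
  hence "p * p7 * (dil 2 psi * dil 14 psi) = (psi * dil 7 psi)\<^sup>2"
    using phi_mult_dil_psi unfolding defs' by algebra
  hence pp7: "p * p7 * C = P\<^sup>2"
    by (simp add: defs psi_psi7_def dil_simps)
  have "alt (p * p7 * C) = alt (P\<^sup>2)"
    by (simp only: pp7)
  hence mm7: "m * m7 * C = P'\<^sup>2"
    by (simp add: defs defs' alt_simps alt_dil_even alt_dil_odd)
  \<comment> \<open>Since \<open>alt kappa\<close> is the inverse of \<open>kappa\<close>, the
    square of \<open>kappa\<close> is tau(q) / tau(-q).\<close>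
  have k2: "kappa\<^sup>2 * (m * p7) = p * m7" "(alt kappa)\<^sup>2 * (p * m7) = m * p7"
  proof -
    have "kappa\<^sup>2 * alt tau = (kappa * alt kappa) * (kappa * dil 2 tau)"
      by (simp add: power2_eq_square mult_ac flip: alt_kappa_mult)
    hence "kappa\<^sup>2 * alt tau = tau"
      by (simp add: kappa_mult_alt_kappa kappa_mult)
    moreover have "kappa\<^sup>2 * (m * p7) = (kappa\<^sup>2 * alt tau) * (p * m)"
      by (simp add: defs' mult_ac flip: alt_tau_mult)
    ultimately show "kappa\<^sup>2 * (m * p7) = p * m7"
      by (simp add: defs' mult_ac flip: tau_mult)
    have "(alt kappa)\<^sup>2 * (p * m7) = (alt kappa)\<^sup>2 * (kappa\<^sup>2 * (m * p7))"
      by (simp only: \<open>kappa\<^sup>2 * (m * p7) = p * m7\<close>)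
    also have "\<dots> = (kappa * alt kappa)\<^sup>2 * (m * p7)"
      by (simp add: power2_eq_square mult_ac)
    finally show "(alt kappa)\<^sup>2 * (p * m7) = m * p7"
      by (simp add: kappa_mult_alt_kappa)
  qed
  have "kappa ^ 4 * (m * p7)\<^sup>2 = (p * m7)\<^sup>2" "alt kappa ^ 4 * (p * m7)\<^sup>2 = (m * p7)\<^sup>2"
    using k2[THEN arg_cong[of _ _ "\<lambda>x. x\<^sup>2"]] by (simp_all add: power_mult_distrib flip: power_mult)
  hence "r4 * (p * p7 * (m * m7))\<^sup>2 = (p * m7) ^ 4 + (m * p7) ^ 4"
    unfolding r4_def by algebra
  \<comment> \<open>Expanding \<open>quartic\<close> trades the mixed products \<open>p * m7\<close>
    and \<open>m * p7\<close> for \<open>p * p7\<close> and \<open>m * m7\<close>, which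
    \<open>pp7\<close> and \<open>mm7\<close> express by \<open>P\<close> and
    \<open>P'\<close>.\<close>
  also have "\<dots> = (p * p7) ^ 4 + (m * m7) ^ 4 - 256 * fps_X ^ 8 * C ^ 4"
    unfolding quartic[symmetric] by (simp add: algebra_simps power_mult_distrib)
  finally have "r4 * (p * p7 * (m * m7))\<^sup>2 * C ^ 4 = ((p * p7) ^ 4 + (m * m7) ^ 4 - 256 * fps_X ^ 8 * C ^ 4) * C ^ 4"
    by simp
  hence "r4 * (p * p7 * C * (m * m7 * C))\<^sup>2 = (p * p7 * C) ^ 4 + (m * m7 * C) ^ 4 - (2 * fps_X * C) ^ 8"
    by (simp add: algebra_simps power_mult_distrib flip: power_add)
  \<comment> \<open>The degree 7 modular equation, in \<open>P\<close> and \<open>P'\<close>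
    alone.\<close>
  hence r4: "r4 * (P * P') ^ 4 = P ^ 8 + P' ^ 8 - (P - P') ^ 8"
    unfolding pp7 mm7 diff by (simp add: power_mult_distrib flip: power_mult)
  have Y: "Y\<^sup>2 = 1 + 8 * dil 2 xi"
    by (simp add: defs xi_def dil_simps power2_eq_square algebra_simps)
  have "(P - P')\<^sup>2 = 4 * dil 2 xi * P * P'"
    unfolding diff using dil_xi_mult by (simp add: defs power_mult_distrib mult.assoc)
  hence YP: "Y\<^sup>2 * (P * P') = P * P' + 2 * (P - P')\<^sup>2"
    unfolding Y by (simp add: algebra_simps)
  have "(kappa\<^sup>2 + (alt kappa)\<^sup>2)\<^sup>2 = r4 + 2 * (kappa * alt kappa)\<^sup>2"
    by (simp add: r4_def power2_eq_square power4_eq_xxxx algebra_simps)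
  hence "(P * P') ^ 4 * (kappa\<^sup>2 + (alt kappa)\<^sup>2)\<^sup>2 = P ^ 8 + P' ^ 8 - (P - P') ^ 8 + 2 * (P * P') ^ 4"
    using r4 by (simp add: kappa_mult_alt_kappa algebra_simps)
  \<comment> \<open>This factorisation becomes a perfect square in terms of \<open>Y\<close>, so
    that a first square root can be taken.\<close>
  also have "\<dots> = (P * P') * (P * P' + 2 * (P - P')\<^sup>2) * (P * P' + (P * P' + 2 * (P - P')\<^sup>2))\<^sup>2"
    by algebra
  also have "\<dots> = (P * P') ^ 4 * (Y * (1 + Y\<^sup>2))\<^sup>2"
    unfolding YP[symmetric] by algebra
  finally have "(kappa\<^sup>2 + (alt kappa)\<^sup>2)\<^sup>2 = (Y * (1 + Y\<^sup>2))\<^sup>2"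
    by (simp add: defs)
  hence "kappa\<^sup>2 + (alt kappa)\<^sup>2 = Y * (1 + Y\<^sup>2)"
    by (rule power2_eq_imp_eq_fps) (simp_all add: defs fps_nth_power_0)
  \<comment> \<open>The second square root: Y^3 + Y + 2 factors as (Y + 1) (Y^2 - Y + 2), which is
    \<open>4 * dil 2 (eps\<^sup>2)\<close>.\<close>
  hence "(kappa + alt kappa)\<^sup>2 = Y * (1 + Y\<^sup>2) + 2"
    using kappa_mult_alt_kappa by algebra
  also have "\<dots> = 4 * ((1 + 2 * dil 2 rho) * (1 + 2 * dil 2 rho + 8 * (dil 2 rho)\<^sup>2))"
    unfolding defs by algebra
  also have "\<dots> = 4 * dil 2 (eps\<^sup>2)"
    unfolding eps_square by (simp add: dil_simps)
  also have "\<dots> = (2 * dil 2 eps)\<^sup>2"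
    by (simp add: dil_simps power_mult_distrib)
  finally show ?thesis
    by (rule power2_eq_imp_eq_fps) simp_all
qed

section \<open>The dissection operator\<close>

lemma even_part_kappa: "even_part kappa = eps"
proof -
  have "2 * dil 2 (even_part kappa) = 2 * dil 2 eps"
    using even_part_doubled[of kappa] kappa_trace by simp
  thus ?thesis by (simp add: dil_inject)
qed

lemma delta_odd: "delta = fps_X * dil 2 (odd_part delta)"
  using odd_part_doubled[of delta] by (simp add: alt_delta)

lemma odd_part_delta_nth_0 [simp]: "fps_nth (odd_part delta) 0 = 1"
  by (simp add: odd_part_def delta_def rho_def dil_nth mult.assoc)

text \<open>Chosen such that the odd exponents of \<open>kappa\<close> form
  \<open>delta * dil 2 beta\<close> divided by \<open>1 + dil 2 xi\<close>. The factor
  \<open>1 + xi\<close> cancels against \<open>delta_square\<close>, which keeps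
  \<open>even_part_kappa_delta\<close> free of denominators.\<close>

definition beta :: "int fps" where
  "beta = (1 + xi) * odd_part kappa * unit_inverse (odd_part delta)"

lemma beta_mult: "beta * odd_part delta = (1 + xi) * odd_part kappa"
  using mult_unit_inverse[of "odd_part delta"] by (simp add: beta_def mult.assoc mult.commute[of "unit_inverse _"])

lemma delta_mult_dil_beta: "2 * delta * dil 2 beta = (1 + dil 2 xi) * (kappa - alt kappa)"
proof -
  have "dil 2 (beta * odd_part delta) = dil 2 ((1 + xi) * odd_part kappa)"
    by (simp only: beta_mult)
  hence "dil 2 beta * dil 2 (odd_part delta) = (1 + dil 2 xi) * dil 2 (odd_part kappa)"
    by (simp add: dil_simps)
  hence "2 * (fps_X * dil 2 (odd_part delta)) * dil 2 beta = (1 + dil 2 xi) * (2 * (fps_X * dil 2 (odd_part kappa)))"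
    by (simp add: mult_ac)
  thus ?thesis
    by (simp only: odd_part_doubled delta_odd[symmetric])
qed

lemma one_plus_xi_nonzero [simp]: "1 + xi \<noteq> 0" "1 + dil 2 xi \<noteq> 0"
  by (auto intro!: fps_nth_0_imp_nonzero)

lemma one_plus_rho_nonzero [simp]: "1 + 2 * rho \<noteq> 0"
  by (auto intro!: fps_nth_0_imp_nonzero)

lemma rho_nonzero [simp]: "rho \<noteq> 0"
proof
  assume "rho = 0"
  with rho_mult have "fps_X * dil 2 psi_psi7 = 0" by simp
  thus False by simp
qed

lemma xi_nonzero [simp]: "xi \<noteq> 0"
proof -
  have "xi = rho * (1 + 2 * rho)"
    by (simp add: xi_def power2_eq_square algebra_simps)
  thus ?thesis
    by (metis mult_eq_0_iff rho_nonzero one_plus_rho_nonzero)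
qed

text \<open>As \<open>kappa\<close> has inverse \<open>alt kappa\<close>, the squares of their
  difference and of their sum differ by 4; trace and \<open>delta_square\<close> are
  inserted.\<close>

lemma xi_beta_square: "xi * beta\<^sup>2 = (1 + xi) * (eps\<^sup>2 - 1)"
proof -
  have "(2 * delta * dil 2 beta)\<^sup>2 = (1 + dil 2 xi)\<^sup>2 * ((kappa + alt kappa)\<^sup>2 - 4 * (kappa * alt kappa))"
    unfolding delta_mult_dil_beta by (simp add: power2_eq_square algebra_simps)
  hence "4 * delta\<^sup>2 * (dil 2 beta)\<^sup>2 = (1 + dil 2 xi)\<^sup>2 * (4 * (dil 2 eps)\<^sup>2 - 4)"
    by (simp add: kappa_mult_alt_kappa kappa_trace power_mult_distrib)
  hence "4 * ((1 + dil 2 xi) * (dil 2 xi * (dil 2 beta)\<^sup>2)) = 4 * ((1 + dil 2 xi) * ((1 + dil 2 xi) * ((dil 2 eps)\<^sup>2 - 1)))"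
    unfolding delta_square by algebra
  hence "dil 2 xi * (dil 2 beta)\<^sup>2 = (1 + dil 2 xi) * ((dil 2 eps)\<^sup>2 - 1)"
    by simp
  hence "dil 2 (xi * beta\<^sup>2) = dil 2 ((1 + xi) * (eps\<^sup>2 - 1))"
    by (simp add: dil_simps)
  thus ?thesis by (simp add: dil_inject)
qed

lemma beta_square: "(1 + 2 * rho) * beta\<^sup>2 = 4 * (1 + xi) * (1 + 3 * rho + 4 * rho\<^sup>2)"
proof -
  have "rho * ((1 + 2 * rho) * beta\<^sup>2) = rho * (4 * (1 + xi) * (1 + 3 * rho + 4 * rho\<^sup>2))"
    using xi_beta_square eps_square unfolding xi_def by algebra
  thus ?thesis by simp
qed

text \<open>The right-hand side involves \<open>xi\<close> alone, so dilation by 2 yields a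
  polynomial in \<open>dil 2 xi\<close>; \<open>beta_dissection\<close> rests on this.\<close>

lemma eps_beta_square: "(eps * beta)\<^sup>2 = 4 * (1 + xi) * (1 + 5 * xi + 8 * xi\<^sup>2)"
  using beta_square eps_square unfolding xi_def by algebra

lemma beta_nth_0: "fps_nth beta 0 \<noteq> 0"
proof
  assume "fps_nth beta 0 = 0"
  hence "fps_nth ((1 + 2 * rho) * beta\<^sup>2) 0 = 0"
    by (simp add: fps_nth_power_0)
  thus False unfolding beta_square by (simp add: fps_nth_power_0)
qed

text \<open>Makes \<open>beta\<close> a multiple of \<open>1 + rho\<close> by a quotient of series
  in q^2. The squares of \<open>(1 + rho) * beta\<close> and
  \<open>(1 + 2 * rho) * dil 2 (eps * beta)\<close> agree, and the nonzero constant coefficient of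
  \<open>beta\<close> fixes the sign.\<close>

lemma beta_dissection: "(1 + dil 2 xi) * beta = (1 + rho) * dil 2 (eps * beta)"
proof -
  have "dil 2 ((eps * beta)\<^sup>2) = dil 2 (4 * (1 + xi) * (1 + 5 * xi + 8 * xi\<^sup>2))"
    by (simp only: eps_beta_square)
  hence sq: "(dil 2 (eps * beta))\<^sup>2 = 4 * (1 + dil 2 xi) * (1 + 5 * dil 2 xi + 8 * (dil 2 xi)\<^sup>2)"
    by (simp add: dil_simps)
  have "(1 + 2 * rho) * ((1 + rho) * beta)\<^sup>2 = (1 + 2 * rho) * ((1 + 2 * rho) * dil 2 (eps * beta))\<^sup>2"
    using sq beta_square rho_square unfolding xi_def by algebra
  hence "((1 + rho) * beta)\<^sup>2 = ((1 + 2 * rho) * dil 2 (eps * beta))\<^sup>2"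
    by simp
  hence "(1 + rho) * beta = (1 + 2 * rho) * dil 2 (eps * beta)"
    by (rule power2_eq_imp_eq_fps) (simp_all add: beta_nth_0)
  moreover have "(1 + rho)\<^sup>2 = (1 + 2 * rho) * (1 + dil 2 xi)"
    using rho_square by algebra
  ultimately have "(1 + 2 * rho) * ((1 + dil 2 xi) * beta) = (1 + 2 * rho) * ((1 + rho) * dil 2 (eps * beta))"
    by algebra
  thus ?thesis by simp
qed

lemma even_part_kappa_delta: "even_part (kappa * delta) = xi * beta"
proof -
  have "2 * dil 2 (even_part (kappa * delta)) = (kappa - alt kappa) * delta"
    unfolding even_part_doubled by (simp add: alt_simps alt_delta algebra_simps)
  hence "(1 + dil 2 xi) * dil 2 (even_part (kappa * delta)) * 2 = 2 * delta * dil 2 beta * delta"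
    unfolding delta_mult_dil_beta by algebra
  also have "\<dots> = (1 + dil 2 xi) * (dil 2 xi * dil 2 beta) * 2"
    using delta_square by algebra
  finally have "dil 2 (even_part (kappa * delta)) = dil 2 (xi * beta)"
    by (simp add: dil_simps)
  thus ?thesis by (simp add: dil_inject)
qed

lemma even_part_kappa_mult:
  "even_part (kappa * (dil 2 c + delta * dil 2 e)) = eps * c + xi * beta * e"
proof -
  have "kappa * (dil 2 c + delta * dil 2 e) = dil 2 c * kappa + dil 2 e * (kappa * delta)"
    by (simp add: algebra_simps)
  thus ?thesis
    by (simp only: even_part_add even_part_mult_dil even_part_kappa even_part_kappa_delta) (simp add: mult_ac)
qed

text \<open>The passage to every second coefficient, stripped of prefactors. It is a division by
  \<open>xi\<close>, which has order 1; shifting numerator and denominator by one makes the latter a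
  unit.\<close>

definition dissect :: "int fps \<Rightarrow> int fps" where
  "dissect F = fps_shift 1 (even_part (kappa * rho * F)) * unit_inverse (fps_shift 1 xi)"

lemma xi_mult_dissect: "xi * dissect F = even_part (kappa * rho * F)"
proof -
  have shift: "fps_X * fps_shift 1 G = G" if "fps_nth G 0 = 0" for G :: "int fps"
    using that by (simp add: fps_shift_times_fps_X'' fps_eq_iff fps_X_mult_nth)
  have "fps_nth (fps_shift 1 xi) 0 = 1"
    by (simp add: xi_def rho_def power2_eq_square mult.assoc)
  hence "fps_shift 1 xi * unit_inverse (fps_shift 1 xi) = 1"
    by (rule mult_unit_inverse)
  moreover have "xi * dissect F = fps_X * fps_shift 1 (even_part (kappa * rho * F)) * (fps_shift 1 xi * unit_inverse (fps_shift 1 xi))"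
    by (subst shift[of xi, symmetric]) (simp_all add: dissect_def mult_ac)
  moreover have "fps_nth (even_part (kappa * rho * F)) 0 = 0"
    by (simp add: even_part_def)
  ultimately show ?thesis
    by (simp only: shift mult_1_right)
qed

lemma dissect_eqI: "even_part (kappa * rho * F) = xi * G \<Longrightarrow> dissect F = G"
  using xi_mult_dissect[of F] by simp

lemma dissect_add: "dissect (F + G) = dissect F + dissect G"
  by (rule dissect_eqI) (simp add: distrib_left even_part_add flip: xi_mult_dissect)

lemma dissect_mult_dil: "dissect (dil 2 G * F) = G * dissect F"
proof (rule dissect_eqI)
  have "kappa * rho * (dil 2 G * F) = dil 2 G * (kappa * rho * F)"
    by (simp add: mult_ac)
  thus "even_part (kappa * rho * (dil 2 G * F)) = xi * (G * dissect F)"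
    by (simp only: even_part_mult_dil mult.left_commute[of xi] xi_mult_dissect)
qed

lemma dissect_of_int: "dissect (of_int k * F) = of_int k * dissect F"
proof -
  have "dil 2 (of_int k) = of_int k"
    by (simp add: dil_def flip: fps_of_int)
  thus ?thesis using dissect_mult_dil[of "of_int k" F] by simp
qed

text \<open>\<open>rho_square\<close> yields a recurrence, so two consecutive powers of
  \<open>rho\<close> determine the action on all higher ones.\<close>

lemma dissect_rho_square: "dissect (rho\<^sup>2 * F) = 2 * xi * dissect (rho * F) + xi * dissect F"
proof -
  have "rho\<^sup>2 * F = dil 2 xi * F + dil 2 (2 * xi) * (rho * F)"
    unfolding rho_square by (simp add: dil_simps algebra_simps)
  thus ?thesis by (simp only: dissect_add dissect_mult_dil) (simp add: algebra_simps)
qed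

lemma dissect_cancel: "dil 2 D * F = dil 2 B * G \<Longrightarrow> D * dissect F = B * dissect G"
  using dissect_mult_dil by metis

lemma dissect_rho_poly: "rho * F = dil 2 (xi * c) + delta * dil 2 (xi * e) \<Longrightarrow> dissect F = eps * c + xi * beta * e"
  by (rule dissect_eqI) (simp only: mult.assoc even_part_kappa_mult, simp add: algebra_simps)

text \<open>The image of 1 under \<open>dissect\<close>, and thereby the starting vector in
  \<open>progression_1\<close>.\<close>

definition alpha :: "int fps" where
  "alpha = eps + beta"

lemma dissect_1: "dissect 1 = alpha"
proof (rule dissect_eqI)
  have "kappa * rho = kappa * (dil 2 xi + delta * dil 2 1)"
    by (simp add: rho_eq_delta dil_1)
  thus "even_part (kappa * rho * 1) = xi * alpha"
    by (simp only: mult_1_right even_part_kappa_mult) (simp add: alpha_def algebra_simps)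
qed

text \<open>\<open>eps\<close> is \<open>1 + 2 * rho\<close> times a series in q^2, which leaves the
  operator as \<open>1 + 4 * rho\<close>.\<close>

lemma dissect_eps:
  shows "dissect eps = (1 + 4 * rho) * (eps * (3 + 4 * xi) + beta * (1 + 4 * xi))"
    and "dissect (rho * eps) = (1 + 4 * rho) * (eps * (1 + 8 * xi + 8 * xi\<^sup>2) + xi * beta * (4 + 8 * xi))"
proof -
  have eps: "eps = dil 2 (1 + 4 * rho) * (1 + 2 * rho)" "rho * eps = dil 2 (1 + 4 * rho) * (rho * (1 + 2 * rho))"
    by (simp_all add: eps_def dil_simps algebra_simps)
  have "dissect (1 + 2 * rho) = eps * (3 + 4 * xi) + beta * (1 + 4 * xi)"
  proof (rule dissect_eqI)
    have "rho * (1 + 2 * rho) = dil 2 (3 * xi + 4 * xi\<^sup>2) + delta * dil 2 (1 + 4 * xi)"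
      using rho_square rho_eq_delta delta_square by (simp add: dil_simps) algebra
    thus "even_part (kappa * rho * (1 + 2 * rho)) = xi * (eps * (3 + 4 * xi) + beta * (1 + 4 * xi))"
      by (simp only: mult.assoc even_part_kappa_mult) (simp add: algebra_simps power2_eq_square)
  qed
  thus "dissect eps = (1 + 4 * rho) * (eps * (3 + 4 * xi) + beta * (1 + 4 * xi))"
    by (simp only: eps(1) dissect_mult_dil)
  have "dissect (rho * (1 + 2 * rho)) = eps * (1 + 8 * xi + 8 * xi\<^sup>2) + xi * beta * (4 + 8 * xi)"
  proof (rule dissect_rho_poly)
    have "rho * (rho * (1 + 2 * rho)) = dil 2 xi * (1 + 4 * dil 2 xi + (4 + 8 * dil 2 xi) * rho)"
      using rho_square by algebra
    thus "rho * (rho * (1 + 2 * rho)) = dil 2 (xi * (1 + 8 * xi + 8 * xi\<^sup>2)) + delta * dil 2 (xi * (4 + 8 * xi))"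
      by (simp add: dil_simps delta_def algebra_simps power2_eq_square)
  qed
  thus "dissect (rho * eps) = (1 + 4 * rho) * (eps * (1 + 8 * xi + 8 * xi\<^sup>2) + xi * beta * (4 + 8 * xi))"
    by (simp only: eps(2) dissect_mult_dil)
qed

text \<open>\<open>beta_dissection\<close> reduces this to polynomials in \<open>rho\<close>. The
  term \<open>xi * beta\<^sup>2\<close> that arises is rewritten by \<open>xi_beta_square\<close>,
  after which \<open>1 + xi\<close> cancels.\<close>

lemma dissect_beta:
  shows "dissect (rho * beta) = beta * eps\<^sup>2 * (1 + 4 * xi) + eps * (eps\<^sup>2 - 1) * (3 + 4 * xi)"
    and "dissect (rho\<^sup>2 * beta) = beta * eps\<^sup>2 * (4 * xi + 8 * xi\<^sup>2) + eps * (eps\<^sup>2 - 1) * (1 + 8 * xi + 8 * xi\<^sup>2)"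
proof -
  have beta: "dil 2 (1 + xi) * (F * beta) = dil 2 (eps * beta) * (F * (1 + rho))" for F
    using beta_dissection by (simp add: dil_simps)
  have "dissect (rho * (1 + rho)) = eps * ((1 + xi) * (1 + 4 * xi)) + xi * beta * (3 + 4 * xi)"
  proof (rule dissect_rho_poly)
    have "rho * (rho * (1 + rho)) = dil 2 xi * (1 + 2 * dil 2 xi + (3 + 4 * dil 2 xi) * rho)"
      using rho_square by algebra
    thus "rho * (rho * (1 + rho)) = dil 2 (xi * ((1 + xi) * (1 + 4 * xi))) + delta * dil 2 (xi * (3 + 4 * xi))"
      by (simp add: dil_simps delta_def algebra_simps power2_eq_square)
  qed
  hence "(1 + xi) * dissect (rho * beta) = (eps * beta) * (eps * ((1 + xi) * (1 + 4 * xi)) + xi * beta * (3 + 4 * xi))"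
    using dissect_cancel[OF beta[of rho]] by simp
  also have "\<dots> = (1 + xi) * (beta * eps\<^sup>2 * (1 + 4 * xi) + eps * (eps\<^sup>2 - 1) * (3 + 4 * xi))"
    using xi_beta_square by algebra
  finally show "dissect (rho * beta) = beta * eps\<^sup>2 * (1 + 4 * xi) + eps * (eps\<^sup>2 - 1) * (3 + 4 * xi)"
    by simp
  have "dissect (rho\<^sup>2 * (1 + rho)) = eps * ((1 + xi) * (4 * xi + 8 * xi\<^sup>2)) + xi * beta * (1 + 8 * xi + 8 * xi\<^sup>2)"
  proof (rule dissect_rho_poly)
    have "rho * (rho\<^sup>2 * (1 + rho)) = dil 2 xi * (3 * dil 2 xi + 4 * (dil 2 xi)\<^sup>2 + (1 + 8 * dil 2 xi + 8 * (dil 2 xi)\<^sup>2) * rho)"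
      using rho_square by algebra
    thus "rho * (rho\<^sup>2 * (1 + rho)) = dil 2 (xi * ((1 + xi) * (4 * xi + 8 * xi\<^sup>2))) + delta * dil 2 (xi * (1 + 8 * xi + 8 * xi\<^sup>2))"
      by (simp add: dil_simps delta_def algebra_simps power2_eq_square)
  qed
  hence "(1 + xi) * dissect (rho\<^sup>2 * beta) = (eps * beta) * (eps * ((1 + xi) * (4 * xi + 8 * xi\<^sup>2)) + xi * beta * (1 + 8 * xi + 8 * xi\<^sup>2))"
    using dissect_cancel[OF beta[of "rho\<^sup>2"]] by simp
  also have "\<dots> = (1 + xi) * (beta * eps\<^sup>2 * (4 * xi + 8 * xi\<^sup>2) + eps * (eps\<^sup>2 - 1) * (1 + 8 * xi + 8 * xi\<^sup>2))"
    using xi_beta_square by algebra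
  finally show "dissect (rho\<^sup>2 * beta) = beta * eps\<^sup>2 * (4 * xi + 8 * xi\<^sup>2) + eps * (eps\<^sup>2 - 1) * (1 + 8 * xi + 8 * xi\<^sup>2)"
    by simp
qed

section \<open>Explicit action on polynomials\<close>

text \<open>Lowest coefficient first. Lists make the operator executable for the finite check in
  \<open>rows\<close>.\<close>

fun rho_poly :: "int list \<Rightarrow> int fps" where
  "rho_poly [] = 0"
| "rho_poly (c # cs) = of_int c + rho * rho_poly cs"

fun list_add :: "int list \<Rightarrow> int list \<Rightarrow> int list" where
  "list_add [] ys = ys"
| "list_add xs [] = xs"
| "list_add (x # xs) (y # ys) = (x + y) # list_add xs ys"

definition list_scale :: "int \<Rightarrow> int list \<Rightarrow> int list" where
  "list_scale k = map (\<lambda>x. k * x)"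

definition list_xi :: "int list \<Rightarrow> int list" where
  "list_xi xs = 0 # list_add xs (0 # list_scale 2 xs)"

lemma rho_poly_add: "rho_poly (list_add xs ys) = rho_poly xs + rho_poly ys"
  by (induction xs ys rule: list_add.induct) (simp_all add: algebra_simps)

lemma rho_poly_scale: "rho_poly (list_scale k xs) = of_int k * rho_poly xs"
  by (induction xs) (simp_all add: list_scale_def algebra_simps)

lemma rho_poly_xi: "rho_poly (list_xi xs) = xi * rho_poly xs"
  by (simp add: list_xi_def xi_def rho_poly_add rho_poly_scale power2_eq_square algebra_simps)

type_synonym coords = "int list \<times> int list"

definition ev :: "coords \<Rightarrow> int fps" where
  "ev p = alpha * rho_poly (fst p) + beta * rho_poly (snd p)"

definition add2 :: "coords \<Rightarrow> coords \<Rightarrow> coords" where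
  "add2 p q = (list_add (fst p) (fst q), list_add (snd p) (snd q))"

definition scale2 :: "int \<Rightarrow> coords \<Rightarrow> coords" where
  "scale2 k p = (list_scale k (fst p), list_scale k (snd p))"

definition xi2 :: "coords \<Rightarrow> coords" where
  "xi2 p = (list_xi (fst p), list_xi (snd p))"

lemma ev_ops:
  "ev (add2 p q) = ev p + ev q" "ev (scale2 k p) = of_int k * ev p" "ev (xi2 p) = xi * ev p"
  by (simp_all add: ev_def add2_def scale2_def xi2_def rho_poly_add rho_poly_scale rho_poly_xi algebra_simps)

text \<open>The arguments \<open>s\<close> and \<open>t\<close> hold the images of a base element
  times two consecutive powers of \<open>rho\<close>; each step advances them by
  \<open>dissect_rho_square\<close>.\<close>

fun dissect_combine :: "int list \<Rightarrow> coords \<Rightarrow> coords \<Rightarrow> coords" where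
  "dissect_combine [] s t = ([], [])"
| "dissect_combine (c # cs) s t = add2 (scale2 c s) (dissect_combine cs t (add2 (scale2 2 (xi2 t)) (xi2 s)))"

lemma dissect_0: "dissect 0 = 0"
  using dissect_of_int[of 0 0] by simp

lemma ev_dissect_combine:
  assumes "ev s = dissect F" "ev t = dissect (rho * F)"
  shows "ev (dissect_combine cs s t) = dissect (F * rho_poly cs)"
  using assms
proof (induction cs arbitrary: F s t)
  case Nil
  show ?case by (simp add: ev_def dissect_0)
next
  case (Cons c cs)
  have "ev (dissect_combine cs t (add2 (scale2 2 (xi2 t)) (xi2 s))) = dissect (rho * F * rho_poly cs)"
    by (rule Cons.IH)
       (simp_all add: ev_ops Cons.prems mult.assoc dissect_rho_square[of F, unfolded power2_eq_square mult.assoc])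
  moreover have "F * rho_poly (c # cs) = of_int c * F + rho * F * rho_poly cs"
    by (simp add: algebra_simps)
  ultimately show ?case
    by (simp add: ev_ops Cons.prems dissect_add dissect_of_int)
qed

text \<open>This and the next three pairs are the images of \<open>rho\<close> and
  \<open>rho\<^sup>2\<close> times \<open>alpha\<close> and \<open>beta\<close>, as
  \<open>dissect_initial\<close> confirms; they start the recurrence.\<close>

definition dissect_alpha1 :: coords where
  "dissect_alpha1 = ([1, 24, 108, 256, 320, 256], [0, - 12, - 40, - 64])"

definition dissect_beta1 :: coords where
  "dissect_beta1 = ([0, 12, 52, 128, 160, 128], [1, - 4, - 16, - 32])"

definition dissect_alpha2 :: coords where
  "dissect_alpha2 = ([0, 9, 94, 424, 1104, 1792, 1792, 1024], [0, - 4, - 44, - 160, - 288, - 256])"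

definition dissect_beta2 :: coords where
  "dissect_beta2 = ([0, 4, 44, 208, 544, 896, 896, 512], [0, 0, - 12, - 64, - 128, - 128])"

lemma eps_eq: "eps = alpha - beta"
  by (simp add: alpha_def)

lemma dissect_initial:
  "dissect (rho * alpha) = ev dissect_alpha1" "dissect (rho * beta) = ev dissect_beta1"
  "dissect (rho * (rho * alpha)) = ev dissect_alpha2" "dissect (rho * (rho * beta)) = ev dissect_beta2"
proof -
  have 1: "eps * (eps\<^sup>2 - 1) = (alpha - beta) * (4 * rho + 12 * rho\<^sup>2 + 16 * rho ^ 3)"
    unfolding eps_square eps_eq[symmetric] by algebra
  have 2: "beta * eps\<^sup>2 = beta * (1 + 4 * rho + 12 * rho\<^sup>2 + 16 * rho ^ 3)"
    unfolding eps_square by algebra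
  note dissect_beta' = dissect_beta[unfolded 1 2 xi_def]
  have ea: "dissect (rho * eps) = (1 + 4 * rho) * ((alpha - beta) * (1 + 8 * xi + 8 * xi\<^sup>2) + xi * beta * (4 + 8 * xi))"
    using dissect_eps(2) unfolding eps_eq[symmetric] .
  have e0: "dissect eps = (1 + 4 * rho) * ((alpha - beta) * (3 + 4 * xi) + beta * (1 + 4 * xi))"
    using dissect_eps(1) unfolding eps_eq[symmetric] .
  show b1: "dissect (rho * beta) = ev dissect_beta1"
    unfolding dissect_beta'(1) by (simp add: ev_def dissect_beta1_def) algebra
  have b2': "dissect (rho * (rho * beta)) = dissect (rho\<^sup>2 * beta)"
    by (simp add: power2_eq_square mult.assoc)
  show b2: "dissect (rho * (rho * beta)) = ev dissect_beta2"
    unfolding b2' dissect_beta'(2) by (simp add: ev_def dissect_beta2_def) algebra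
  have "dissect (rho * alpha) = dissect (rho * eps) + dissect (rho * beta)"
    unfolding alpha_def distrib_left dissect_add ..
  also have "\<dots> = ev dissect_alpha1"
    unfolding ea b1 xi_def by (simp add: ev_def dissect_alpha1_def dissect_beta1_def) algebra
  finally show "dissect (rho * alpha) = ev dissect_alpha1" .
  have "dissect (rho * (rho * alpha)) = dissect (rho\<^sup>2 * eps) + dissect (rho * (rho * beta))"
    unfolding alpha_def distrib_left dissect_add power2_eq_square mult.assoc ..
  also have "\<dots> = ev dissect_alpha2"
    unfolding dissect_rho_square ea e0 b2 xi_def by (simp add: ev_def dissect_alpha2_def dissect_beta2_def) algebra
  finally show "dissect (rho * (rho * alpha)) = ev dissect_alpha2" .
qed

definition dissect_coords :: "coords \<Rightarrow> coords" where
  "dissect_coords p = add2 (dissect_combine (fst p) dissect_alpha1 dissect_alpha2) (dissect_combine (snd p) dissect_beta1 dissect_beta2)"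

lemma ev_dissect_coords: "ev (dissect_coords p) = dissect (rho * ev p)"
proof -
  have "ev (dissect_coords p) = dissect (rho * alpha * rho_poly (fst p)) + dissect (rho * beta * rho_poly (snd p))"
    by (simp add: dissect_coords_def ev_ops ev_dissect_combine[of _ "rho * alpha"] ev_dissect_combine[of _ "rho * beta"] dissect_initial)
  also have "\<dots> = dissect (rho * ev p)"
    by (simp add: ev_def algebra_simps flip: dissect_add)
  finally show ?thesis .
qed

definition shift2 :: "coords \<Rightarrow> coords" where
  "shift2 p = (0 # fst p, 0 # snd p)"

lemma ev_shift2: "ev (shift2 p) = rho * ev p"
  by (simp add: ev_def shift2_def algebra_simps)

text \<open>Leads from a progression of even index to the next one of even index;
  \<open>rho\<^sup>2\<close> comes from \<open>even_part_prefactor\<close>.\<close>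

definition two_step :: "int fps \<Rightarrow> int fps" where
  "two_step F = dissect (rho\<^sup>2 * dissect F)"

definition two_step_coords :: "coords \<Rightarrow> coords" where
  "two_step_coords p = dissect_coords (shift2 (dissect_coords p))"

lemma ev_two_step_coords: "ev (two_step_coords p) = two_step (rho * ev p)"
  by (simp add: two_step_coords_def two_step_def ev_dissect_coords ev_shift2 power2_eq_square mult.assoc)

text \<open>Exponent of 2 attached to \<open>rho ^ n\<close> in the lattice. The rate n / 2 is
  matched to the halving of exponents in \<open>dissect_rho_power_slope\<close>; the first values
  fit the finite check \<open>rows\<close>.\<close>

definition weight :: "nat \<Rightarrow> nat" where
  "weight n = (if n \<le> 2 then 0 else if n = 3 then 2 else n div 2)"

fun divisible_from :: "nat \<Rightarrow> int list \<Rightarrow> bool" where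
  "divisible_from n [] \<longleftrightarrow> True"
| "divisible_from n (c # cs) \<longleftrightarrow> 4 * 2 ^ weight n dvd c \<and> divisible_from (Suc n) cs"

text \<open>Removes the cubic term by subtracting a multiple of \<open>4 * (rho ^ 3 - 2 * rho ^ 4)\<close>.\<close>

definition remove_cubic :: "int list \<Rightarrow> int list" where
  "remove_cubic cs = (case cs of c0 # c1 # c2 # c3 # _ \<Rightarrow> list_add cs (list_scale (- (c3 div 4)) [0, 0, 0, 4, - 8]) | _ \<Rightarrow> cs)"

text \<open>Executable certificate: up to \<open>k\<close> times \<open>dissect_alpha2\<close>, the
  image of \<open>rho * ev p\<close> lies in 4 times the lattice. The conditions on
  \<open>hd\<close> exclude constant terms.\<close>

definition row_ok :: "int \<Rightarrow> coords \<Rightarrow> bool" where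
  "row_ok k p \<longleftrightarrow> (case add2 (two_step_coords p) (scale2 (- k) dissect_alpha2) of (f, g) \<Rightarrow>
     f \<noteq> [] \<and> hd f = 0 \<and> divisible_from 1 (tl (remove_cubic f)) \<and> hd (remove_cubic f) = 0 \<and> g \<noteq> [] \<and> hd g = 0 \<and> divisible_from 1 (tl g))"

text \<open>The lattice generators of degree at most 5, each divided by \<open>rho\<close>. Modulo 4
  times the lattice the images are \<open>dissect_alpha2\<close> or 0, which is the rank one
  statement; higher degrees are left to \<open>two_step_high\<close>.\<close>

lemma rows:
  "row_ok 1 ([1], [])" "row_ok 1 ([0, 1], [])" "row_ok 1 ([0, 0, 1, - 2], [])"
  "row_ok 0 ([0, 0, 4], [])" "row_ok 0 ([0, 0, 0, 4], [])" "row_ok 0 ([0, 0, 0, 0, 4], [])"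
  "row_ok 0 ([], [1])" "row_ok 0 ([], [0, 1])" "row_ok 0 ([], [0, 0, 4])"
  "row_ok 0 ([], [0, 0, 0, 4])" "row_ok 0 ([], [0, 0, 0, 0, 4])"
  by code_simp+

section \<open>A contracted lattice\<close>

inductive_set zspan :: "int fps set \<Rightarrow> int fps set" for G where
  zero: "0 \<in> zspan G"
| gen: "g \<in> G \<Longrightarrow> g \<in> zspan G"
| diff: "x \<in> zspan G \<Longrightarrow> y \<in> zspan G \<Longrightarrow> x - y \<in> zspan G"

lemma zspan_add: "x \<in> zspan G \<Longrightarrow> y \<in> zspan G \<Longrightarrow> x + y \<in> zspan G"
  using zspan.diff[of x G "0 - y"] zspan.diff[OF zspan.zero] by simp

lemma zspan_of_nat: "x \<in> zspan G \<Longrightarrow> of_nat k * x \<in> zspan G"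
  by (induction k) (auto simp: distrib_right intro: zspan.zero zspan_add)

lemma zspan_of_int: "x \<in> zspan G \<Longrightarrow> of_int k * x \<in> zspan G"
  using zspan_of_nat[of x G "nat \<bar>k\<bar>"] zspan.diff[OF zspan.zero, of "of_nat (nat \<bar>k\<bar>) * x"]
  by (cases "k \<ge> 0") (simp_all add: of_nat_nat)

lemma zspan_numeral: "x \<in> zspan G \<Longrightarrow> numeral k * x \<in> zspan G"
  using zspan_of_int[of x G "numeral k"] by simp

lemma zspan_image:
  assumes "x \<in> zspan G" and "\<And>g. g \<in> G \<Longrightarrow> f g \<in> H"
    and "\<And>x y. f (x - y) = f x - f y" and "\<And>x y. x \<in> H \<Longrightarrow> y \<in> H \<Longrightarrow> x - y \<in> H" and "0 \<in> H"
  shows "f x \<in> (H :: int fps set)"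
proof -
  have "f 0 = 0" using assms(3)[of 0 0] by simp
  with assms(1) show ?thesis
    by induction (simp_all add: assms(2-5))
qed

lemma zspan_image_zspan:
  assumes "x \<in> zspan G" and "\<And>g. g \<in> G \<Longrightarrow> f g \<in> zspan H" and "\<And>x y. f (x - y) = f x - f y"
  shows "f x \<in> zspan H"
  using assms by (rule zspan_image) (auto intro: zspan.diff zspan.zero)

lemma dissect_diff: "dissect (F - G) = dissect F - dissect G"
  using dissect_add[of "F - G" G] by (simp add: eq_diff_eq)

lemma two_step_diff: "two_step (F - G) = two_step F - two_step G"
  by (simp add: two_step_def dissect_diff right_diff_distrib)

text \<open>Lowest power \<open>rho ^ m\<close>, each further power costing one more factor 2;
  \<open>xi\<close>, being \<open>rho + 2 * rho\<^sup>2\<close>, follows this pattern.\<close>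

definition slope_gens :: "nat \<Rightarrow> int fps set" where
  "slope_gens m = {2 ^ j * rho ^ (m + j) * c | j c. c \<in> {alpha, beta}}"

abbreviation "slope m \<equiv> zspan (slope_gens m)"

lemma slope_gen: "c \<in> {alpha, beta} \<Longrightarrow> 2 ^ j * rho ^ (m + j) * c \<in> slope m"
  by (rule zspan.gen) (auto simp: slope_gens_def)

lemma slope_double_Suc: "x \<in> slope (Suc m) \<Longrightarrow> 2 * x \<in> slope m"
proof (erule zspan_image_zspan)
  fix g assume "g \<in> slope_gens (Suc m)"
  then obtain j c where "g = 2 ^ j * rho ^ (Suc m + j) * c" "c \<in> {alpha, beta}"
    by (auto simp: slope_gens_def)
  thus "2 * g \<in> slope m"
    using slope_gen[of c "Suc j" m] by (simp add: mult.assoc)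
qed (simp add: algebra_simps)

lemma slope_xi: "x \<in> slope m \<Longrightarrow> xi * x \<in> slope (Suc m)"
proof (erule zspan_image_zspan)
  fix g assume "g \<in> slope_gens m"
  then obtain j c where g: "g = 2 ^ j * rho ^ (m + j) * c" and c: "c \<in> {alpha, beta}"
    by (auto simp: slope_gens_def)
  have "xi * g = 2 ^ j * rho ^ (Suc m + j) * c + 2 ^ Suc j * rho ^ (Suc m + Suc j) * c"
    by (simp add: g xi_def power2_eq_square algebra_simps)
  thus "xi * g \<in> slope (Suc m)"
    using slope_gen[OF c] zspan_add by metis
qed (simp add: algebra_simps)

fun even_scaled :: "int \<Rightarrow> int list \<Rightarrow> bool" where
  "even_scaled k [] \<longleftrightarrow> True"
| "even_scaled k (c # cs) \<longleftrightarrow> k dvd c \<and> even_scaled (2 * k) cs"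

lemma even_scaled_slope:
  assumes "even_scaled (2 ^ j) cs" "c \<in> {alpha, beta}"
  shows "rho ^ (m + j) * c * rho_poly cs \<in> slope m"
  using assms(1)
proof (induction cs arbitrary: j)
  case (Cons a cs)
  then obtain b where b: "a = 2 ^ j * b" by (auto elim: dvdE)
  have "of_int b * (2 ^ j * rho ^ (m + j) * c) \<in> slope m"
    using slope_gen[OF assms(2)] by (rule zspan_of_int)
  moreover have "rho ^ (m + Suc j) * c * rho_poly cs \<in> slope m"
    using Cons by (intro Cons.IH) simp
  moreover have "rho ^ (m + j) * c * rho_poly (a # cs) =
      of_int b * (2 ^ j * rho ^ (m + j) * c) + rho ^ (m + Suc j) * c * rho_poly cs"
    by (simp add: b algebra_simps)
  ultimately show ?case by (simp only: zspan_add)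
qed (simp add: zspan.zero)

lemma ev_in_slope_0:
  assumes "even_scaled 1 (fst p)" "even_scaled 1 (snd p)"
  shows "ev p \<in> slope 0"
proof -
  have "alpha * rho_poly (fst p) \<in> slope 0" "beta * rho_poly (snd p) \<in> slope 0"
    using even_scaled_slope[of 0 _ _ 0] assms by simp_all
  thus ?thesis unfolding ev_def by (rule zspan_add)
qed

lemma ev_in_slope_1:
  assumes "even_scaled 1 f" "even_scaled 1 g"
  shows "ev (0 # f, 0 # g) \<in> slope 1"
proof -
  have "rho * alpha * rho_poly f \<in> slope 1" "rho * beta * rho_poly g \<in> slope 1"
    using even_scaled_slope[of 0 _ _ 1] assms by simp_all
  moreover have "ev (0 # f, 0 # g) = rho * alpha * rho_poly f + rho * beta * rho_poly g"
    by (simp add: ev_def mult_ac)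
  ultimately show ?thesis by (simp only: zspan_add)
qed

text \<open>In the recurrence, \<open>xi\<close> raises the lowest power by one for every two powers
  of \<open>rho\<close>; the cases 1 and 2 are read off the explicit lists.\<close>

lemma dissect_rho_power_slope:
  assumes "c \<in> {alpha, beta}" "n \<ge> 1"
  shows "dissect (rho ^ n * c) \<in> slope (n div 2)"
  using assms(2)
proof (induction n rule: less_induct)
  case (less n)
  consider "n = 1" | "n = 2" | "n \<ge> 3" using less.prems by linarith
  thus ?case
  proof cases
    case 1
    have "ev dissect_alpha1 \<in> slope 0" "ev dissect_beta1 \<in> slope 0"
      by (rule ev_in_slope_0; simp add: dissect_alpha1_def dissect_beta1_def)+
    thus ?thesis using 1 assms(1) by (auto simp: dissect_initial)
  next
    case 2
    have "ev dissect_alpha2 \<in> slope 1" "ev dissect_beta2 \<in> slope 1"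
      unfolding dissect_alpha2_def dissect_beta2_def by (rule ev_in_slope_1; simp)+
    thus ?thesis using 2 assms(1) by (auto simp: dissect_initial power2_eq_square mult.assoc)
  next
    case 3
    define k where "k = n - 2"
    have n: "n = k + 2" "k \<ge> 1" using 3 by (simp_all add: k_def)
    have IH: "dissect (rho ^ k * c) \<in> slope (k div 2)" "dissect (rho ^ Suc k * c) \<in> slope (Suc k div 2)"
      using n by (auto intro!: less.IH simp del: power_Suc)
    \<comment> \<open>For odd \<open>k\<close> the image of the larger power lies one level higher,
      and the factor 2 brings it down.\<close>
    have "2 * dissect (rho ^ Suc k * c) \<in> slope (k div 2)"
    proof (cases "even k")
      case True
      thus ?thesis using IH(2) by (auto intro: zspan_numeral elim!: evenE)
    next
      case False
      hence "Suc k div 2 = Suc (k div 2)" by presburger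
      thus ?thesis using IH(2) slope_double_Suc by metis
    qed
    hence "xi * (2 * dissect (rho ^ Suc k * c) + dissect (rho ^ k * c)) \<in> slope (Suc (k div 2))"
      using IH(1) by (intro slope_xi zspan_add)
    moreover have "dissect (rho ^ n * c) = xi * (2 * dissect (rho ^ Suc k * c) + dissect (rho ^ k * c))"
    proof -
      have "rho ^ n * c = rho\<^sup>2 * (rho ^ k * c)"
        by (simp add: n power2_eq_square mult_ac)
      thus ?thesis by (simp only: dissect_rho_square) (simp add: algebra_simps)
    qed
    moreover have "Suc (k div 2) = n div 2" using n by simp
    ultimately show ?thesis by simp
  qed
qed

text \<open>
  The last generator is forced: modulo \<open>4\<close> and up to a multiple of \<open>ev dissect_alpha2\<close>, the operator
  \<open>two_step\<close> maps \<open>rho ^ 3 * alpha\<close> to \<open>2 * rho\<^sup>2 * alpha\<close> and \<open>rho ^ 4 * alpha\<close> to an odd multiple of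
  \<open>rho\<^sup>2 * alpha\<close>, so only this combination of the two is contracted.
\<close>

definition lattice_gens :: "int fps set" where
  "lattice_gens = {2 ^ weight n * rho ^ n * c | n c. n \<ge> 1 \<and> c \<in> {alpha, beta}} \<union> {(rho ^ 3 - 2 * rho ^ 4) * alpha}"

abbreviation "lattice \<equiv> zspan lattice_gens"

text \<open>Rank one modulo 4: up to 4 times the lattice, only multiples of a single vector.\<close>

definition target :: "int fps set" where
  "target = {of_int k * ev dissect_alpha2 + 4 * y | k y. y \<in> lattice}"

lemma lattice_gen: "n \<ge> 1 \<Longrightarrow> c \<in> {alpha, beta} \<Longrightarrow> 2 ^ weight n * rho ^ n * c \<in> lattice"
  by (rule zspan.gen) (unfold lattice_gens_def, blast)

lemma targetI: "y \<in> lattice \<Longrightarrow> x = of_int k * ev dissect_alpha2 + 4 * y \<Longrightarrow> x \<in> target"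
  by (auto simp: target_def)

lemma target_diff: "x \<in> target \<Longrightarrow> y \<in> target \<Longrightarrow> x - y \<in> target"
proof -
  assume "x \<in> target" "y \<in> target"
  then obtain k l u v where "x = of_int k * ev dissect_alpha2 + 4 * u" "y = of_int l * ev dissect_alpha2 + 4 * v"
    "u \<in> lattice" "v \<in> lattice"
    unfolding target_def by blast
  hence "x - y = of_int (k - l) * ev dissect_alpha2 + 4 * (u - v)" "u - v \<in> lattice"
    by (simp_all add: algebra_simps zspan.diff)
  thus ?thesis unfolding target_def by blast
qed

lemma divisible_from_lattice:
  assumes "divisible_from n cs" "n \<ge> 1" "c \<in> {alpha, beta}"
  shows "\<exists>y\<in>lattice. rho ^ n * c * rho_poly cs = 4 * y"
  using assms(1,2)
proof (induction cs arbitrary: n)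
  case Nil
  show ?case by (rule bexI[of _ 0]) (simp_all add: zspan.zero)
next
  case (Cons a cs)
  then obtain b where b: "a = 4 * 2 ^ weight n * b" by (auto elim: dvdE)
  obtain y where y: "y \<in> lattice" "rho ^ Suc n * c * rho_poly cs = 4 * y"
    using Cons.IH[of "Suc n"] Cons.prems by auto
  have "of_int b * (2 ^ weight n * rho ^ n * c) + y \<in> lattice"
    using lattice_gen[OF Cons.prems(2) assms(3)] y by (intro zspan_add zspan_of_int)
  moreover have "rho ^ n * c * rho_poly (a # cs) = 4 * (of_int b * (2 ^ weight n * rho ^ n * c) + y)"
    unfolding distrib_left y(2)[symmetric] by (simp add: b algebra_simps)
  ultimately show ?case by blast
qed

lemma row_ok_target:
  assumes "row_ok k p"
  shows "two_step (rho * ev p) \<in> target"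
proof -
  obtain f g where fg: "add2 (two_step_coords p) (scale2 (- k) dissect_alpha2) = (f, g)" by force
  with assms obtain f' g' where f: "f = 0 # f'" and g: "g = 0 # g'" and
    dvd: "divisible_from 1 (tl (remove_cubic f))" "divisible_from 1 g'" and hd: "hd (remove_cubic f) = 0"
    by (cases f; cases g) (auto simp: row_ok_def)
  \<comment> \<open>Here \<open>l\<close> counts the copies of
    \<open>4 * rho ^ 3 - 8 * rho ^ 4\<close> that \<open>remove_cubic\<close> took out, and is 0 for
    lists too short for it.\<close>
  obtain l f'' where l: "remove_cubic f = f''" "rho_poly f = rho_poly f'' + of_int l * (4 * rho ^ 3 - 8 * rho ^ 4)" "f'' \<noteq> []"
  proof (cases "\<exists>c1 c2 c3 cs. f = 0 # c1 # c2 # c3 # cs")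
    case True
    then obtain c1 c2 c3 cs where "f = 0 # c1 # c2 # c3 # cs" by blast
    hence s: "remove_cubic f = list_add f (list_scale (- (c3 div 4)) [0, 0, 0, 4, - 8])"
      by (simp add: remove_cubic_def)
    show ?thesis
    proof (rule that[OF s])
      show "rho_poly f = rho_poly (list_add f (list_scale (- (c3 div 4)) [0, 0, 0, 4, - 8])) +
          of_int (c3 div 4) * (4 * rho ^ 3 - 8 * rho ^ 4)"
        unfolding rho_poly_add rho_poly_scale by (simp add: algebra_simps eval_nat_numeral)
      show "list_add f (list_scale (- (c3 div 4)) [0, 0, 0, 4, - 8]) \<noteq> []"
        by (simp add: f list_scale_def)
    qed
  next
    case False
    hence "remove_cubic f = f" by (auto simp: remove_cubic_def f split: list.splits)
    thus ?thesis by (rule that[of f 0]) (simp_all add: f)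
  qed
  obtain h where h: "f'' = 0 # h"
    using hd l by (cases f'') auto
  have "divisible_from 1 h" using dvd(1) l h by simp
  then obtain y where y: "y \<in> lattice" "rho ^ 1 * alpha * rho_poly h = 4 * y"
    using divisible_from_lattice[of 1 h alpha] by blast
  obtain z where z: "z \<in> lattice" "rho ^ 1 * beta * rho_poly g' = 4 * z"
    using divisible_from_lattice[of 1 g' beta] dvd(2) by blast
  have "(rho ^ 3 - 2 * rho ^ 4) * alpha \<in> lattice"
    by (rule zspan.gen) (simp add: lattice_gens_def)
  hence "y + of_int l * ((rho ^ 3 - 2 * rho ^ 4) * alpha) + z \<in> lattice"
    using y z by (intro zspan_add zspan_of_int)
  moreover have "ev (f, g) = 4 * (y + of_int l * ((rho ^ 3 - 2 * rho ^ 4) * alpha) + z)"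
    unfolding distrib_left y(2)[symmetric] z(2)[symmetric]
    by (simp add: ev_def l(2) h g algebra_simps)
  moreover have "two_step (rho * ev p) = of_int k * ev dissect_alpha2 + ev (f, g)"
    unfolding fg[symmetric] by (simp add: ev_ops ev_two_step_coords)
  ultimately show ?thesis by (simp only: targetI)
qed

lemma four_lattice_target: "y \<in> lattice \<Longrightarrow> 4 * y \<in> target"
  by (rule targetI[of y _ 0]) simp_all

lemma lattice_power:
  assumes "n \<ge> 1" "c \<in> {alpha, beta}" "weight n \<le> k"
  shows "2 ^ k * rho ^ n * c \<in> lattice"
proof -
  have "2 ^ k = 2 ^ (k - weight n) * (2 ^ weight n :: int fps)"
    using assms(3) by (simp flip: power_add)
  hence "2 ^ k * rho ^ n * c = of_int (2 ^ (k - weight n)) * (2 ^ weight n * rho ^ n * c)"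
    by (simp only: of_int_power of_int_numeral mult.assoc)
  moreover have "of_int (2 ^ (k - weight n)) * (2 ^ weight n * rho ^ n * c) \<in> lattice"
    by (intro zspan_of_int lattice_gen assms)
  ultimately show ?thesis by (simp only:)
qed

text \<open>With m = n div 2, two applications of the slope bound lead to terms 2^(i+j) rho^N, where
  N = (m + j + 2) div 2 + i. The weight contributes 2^m, and for m >= 3 the exponent m + i + j
  exceeds \<open>weight N\<close> by at least 2, hence the factor 4.\<close>

lemma two_step_high:
  assumes c: "c \<in> {alpha, beta}" and n: "n \<ge> 6"
  shows "two_step (2 ^ weight n * rho ^ n * c) \<in> target"
proof -
  define m where "m = n div 2"
  have m: "m \<ge> 3" "weight n = m" using n by (auto simp: m_def weight_def)
  have "dissect (rho ^ n * c) \<in> slope m"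
    unfolding m_def using c n by (intro dissect_rho_power_slope) auto
  moreover have "2 ^ m * dissect (rho\<^sup>2 * g) \<in> target" if mem: "g \<in> slope_gens m" for g
  proof -
    obtain j d where g: "g = 2 ^ j * rho ^ (m + j) * d" and d: "d \<in> {alpha, beta}"
        using mem unfolding slope_gens_def by blast
    have "dissect (rho ^ (m + j + 2) * d) \<in> slope ((m + j + 2) div 2)"
      using d by (intro dissect_rho_power_slope) auto
    moreover have "2 ^ (m + j) * h \<in> target" if mem: "h \<in> slope_gens ((m + j + 2) div 2)" for h
    proof -
      obtain i e where h: "h = 2 ^ i * rho ^ ((m + j + 2) div 2 + i) * e" and e: "e \<in> {alpha, beta}"
          using mem unfolding slope_gens_def by blast
      define N where "N = (m + j + 2) div 2 + i"
      have "N \<ge> 1" "weight N \<le> m + j + i - 2"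
        using m(1) by (auto simp: N_def weight_def)
      hence "2 ^ (m + j + i - 2) * rho ^ N * e \<in> lattice"
        using e by (intro lattice_power)
      moreover have "2 ^ (m + j) * h = 4 * (2 ^ (m + j + i - 2) * rho ^ N * e)"
      proof -
        have "m + j + i = 2 + (m + j + i - 2)"
          using m(1) by simp
        hence "2 ^ (m + j + i) = (2 ^ 2 * 2 ^ (m + j + i - 2) :: int fps)"
          by (metis power_add)
        thus ?thesis by (simp add: h N_def power_add mult_ac)
      qed
      ultimately show ?thesis using four_lattice_target by simp
    qed
    ultimately have "2 ^ (m + j) * dissect (rho ^ (m + j + 2) * d) \<in> target"
      by (rule zspan_image[where f = "\<lambda>x. 2 ^ (m + j) * x"])
         (auto simp: algebra_simps intro: target_diff four_lattice_target[of 0, simplified] zspan.zero)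
    moreover have "dissect (rho\<^sup>2 * g) = 2 ^ j * dissect (rho ^ (m + j + 2) * d)"
      using dissect_of_int[of "2 ^ j" "rho ^ (m + j + 2) * d"] by (simp add: g power_add power2_eq_square mult_ac)
    ultimately show ?thesis by (simp add: power_add mult_ac)
  qed
  ultimately have "2 ^ m * dissect (rho\<^sup>2 * dissect (rho ^ n * c)) \<in> target"
    by (rule zspan_image[where f = "\<lambda>x. 2 ^ m * dissect (rho\<^sup>2 * x)"])
       (auto simp: algebra_simps dissect_diff intro: target_diff four_lattice_target[of 0, simplified] zspan.zero)
  moreover have "two_step (2 ^ m * (rho ^ n * c)) = 2 ^ m * dissect (rho\<^sup>2 * dissect (rho ^ n * c))"
  proof -
    have "dissect (2 ^ m * F) = 2 ^ m * dissect F" for F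
      using dissect_of_int[of "2 ^ m" F] by simp
    thus ?thesis by (simp only: two_step_def mult.left_commute[of "rho\<^sup>2"])
  qed
  ultimately show ?thesis by (simp add: m(2) mult.assoc)
qed

lemma two_step_lattice_gens: "g \<in> lattice_gens \<Longrightarrow> two_step g \<in> target"
proof -
  assume "g \<in> lattice_gens"
  then consider (high) n c where "g = 2 ^ weight n * rho ^ n * c" "n \<ge> 6" "c \<in> {alpha, beta}"
    | (low) n c where "g = 2 ^ weight n * rho ^ n * c" "n \<in> {1, 2, 3, 4, 5}" "c \<in> {alpha, beta}"
    | (extra) "g = (rho ^ 3 - 2 * rho ^ 4) * alpha"
    unfolding lattice_gens_def by force
  thus ?thesis
  proof cases
    case high
    thus ?thesis using two_step_high by blast
  next
    case extra
    have "two_step (rho * ev ([0, 0, 1, - 2], [])) \<in> target"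
      by (rule row_ok_target[OF rows(3)])
    thus ?thesis by (simp add: extra ev_def algebra_simps eval_nat_numeral)
  next
    case low
    note rows' = rows[THEN row_ok_target]
    have weights: "weight (Suc 0) = 0" "weight (Suc (Suc 0)) = 0" "weight (Suc (Suc (Suc 0))) = Suc (Suc 0)"
      "weight (Suc (Suc (Suc (Suc 0)))) = Suc (Suc 0)" "weight (Suc (Suc (Suc (Suc (Suc 0))))) = Suc (Suc 0)"
      by (simp_all add: weight_def)
    note simps = ev_def weights algebra_simps eval_nat_numeral
    from low show ?thesis
      using rows'(1) rows'(2) rows'(4) rows'(5) rows'(6) rows'(7) rows'(8) rows'(9) rows'(10) rows'(11)
      by (auto simp: simps)
  qed
qed

section \<open>The congruence\<close>

lemma two_step_lattice: "x \<in> lattice \<Longrightarrow> two_step x \<in> target"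
  by (erule zspan_image)
     (auto simp: two_step_lattice_gens two_step_diff intro: target_diff four_lattice_target[of 0, simplified] zspan.zero)

lemma dissect_alpha2_lattice: "ev dissect_alpha2 \<in> lattice"
proof -
  \<comment> \<open>The lists of \<open>dissect_alpha2\<close> without their zero heads, the cubic
    coefficient 424 being moved into the extra generator: 1104 + 2 * 424 = 1952.\<close>
  define f where "f = [9, 94, 0, 1952, 1792, 1792, 1024 :: int]"
  define g where "g = [- 4, - 44, - 160, - 288, - 256 :: int]"
  have "divisible_from 1 (list_scale 4 f)" "divisible_from 1 (list_scale 4 g)"
    by (simp_all add: f_def g_def list_scale_def weight_def)
  then obtain y z where y: "y \<in> lattice" "rho ^ 1 * alpha * rho_poly (list_scale 4 f) = 4 * y"
    and z: "z \<in> lattice" "rho ^ 1 * beta * rho_poly (list_scale 4 g) = 4 * z"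
    using divisible_from_lattice[of 1 "list_scale 4 f" alpha] divisible_from_lattice[of 1 "list_scale 4 g" beta] by auto
  have "4 * (rho * alpha * rho_poly f) = 4 * y" "4 * (rho * beta * rho_poly g) = 4 * z"
    using y(2) z(2) by (simp_all add: rho_poly_scale mult_ac)
  hence "rho * alpha * rho_poly f = y" "rho * beta * rho_poly g = z"
    by simp_all
  moreover have "ev dissect_alpha2 = rho * alpha * rho_poly f + rho * beta * rho_poly g + of_int 424 * ((rho ^ 3 - 2 * rho ^ 4) * alpha)"
    by (simp add: ev_def dissect_alpha2_def f_def g_def algebra_simps eval_nat_numeral)
  moreover have "(rho ^ 3 - 2 * rho ^ 4) * alpha \<in> lattice"
    by (rule zspan.gen) (simp add: lattice_gens_def)
  ultimately show ?thesis
    using y(1) z(1) by (simp only: zspan_add zspan_of_int)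
qed

lemma two_step_pow_linear: "(two_step ^^ k) (of_int a * x + of_int b * y) = of_int a * (two_step ^^ k) x + of_int b * (two_step ^^ k) y"
proof (induction k)
  case (Suc k)
  have "two_step (of_int a * x + of_int b * y) = of_int a * two_step x + of_int b * two_step y" for x y
    using dissect_of_int[of a] dissect_of_int[of b]
    by (simp add: two_step_def dissect_add distrib_left mult.left_commute[of "rho\<^sup>2"])
  with Suc show ?case by simp
qed simp

text \<open>The minor is bilinear and alternating. When both images are written as a multiple of
  \<open>v\<close> plus 4 times a lattice element, the term in \<open>v\<close> and \<open>v\<close>
  vanishes and every other term carries a factor 4.\<close>

lemma two_step_pow_wedge:
  fixes f g :: "int fps \<Rightarrow> int"
  assumes f: "\<And>a b x y. f (of_int a * x + of_int b * y) = a * f x + b * f y"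
    and g: "\<And>a b x y. g (of_int a * x + of_int b * y) = a * g x + b * g y"
    and "x \<in> lattice" "y \<in> lattice"
  shows "4 ^ k dvd f ((two_step ^^ k) x) * g ((two_step ^^ k) y) - f ((two_step ^^ k) y) * g ((two_step ^^ k) x)"
  using assms(3,4)
proof (induction k arbitrary: x y)
  case (Suc k)
  define v where "v = ev dissect_alpha2"
  have v: "v \<in> lattice" unfolding v_def by (rule dissect_alpha2_lattice)
  obtain a x' where x': "two_step x = of_int a * v + of_int 4 * x'" "x' \<in> lattice"
    using two_step_lattice[OF Suc.prems(1)] by (auto simp: target_def v_def)
  obtain b y' where y': "two_step y = of_int b * v + of_int 4 * y'" "y' \<in> lattice"
    using two_step_lattice[OF Suc.prems(2)] by (auto simp: target_def v_def)
  define w where "w = (\<lambda>x y. f ((two_step ^^ k) x) * g ((two_step ^^ k) y) - f ((two_step ^^ k) y) * g ((two_step ^^ k) x))"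
  have w: "4 ^ k dvd w x y" if "x \<in> lattice" "y \<in> lattice" for x y
    unfolding w_def using Suc.IH that by blast
  have "f ((two_step ^^ Suc k) x) * g ((two_step ^^ Suc k) y) - f ((two_step ^^ Suc k) y) * g ((two_step ^^ Suc k) x) = w (two_step x) (two_step y)"
    by (simp add: w_def funpow_swap1)
  also have "\<dots> = 4 * (a * w v y' + b * w x' v + 4 * w x' y')"
    unfolding x'(1) y'(1) w_def two_step_pow_linear f g by (simp add: algebra_simps)
  moreover have "4 ^ k dvd a * w v y' + b * w x' v + 4 * w x' y'"
    using w[OF v y'(2)] w[OF x'(2) v] w[OF x'(2) y'(2)] by (intro dvd_add dvd_mult)
  ultimately show ?case
    by (simp only: power_Suc mult_dvd_mono dvd_refl)
qed simp

text \<open>Since \<open>two_step v\<close> is a multiple of \<open>v\<close> plus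
  \<open>4 * y\<close>, consecutive iterates of \<open>v\<close> give one factor 4 beyond the
  \<open>k\<close> factors of \<open>two_step_pow_wedge\<close>.\<close>

lemma two_step_pow_consecutive:
  fixes f g :: "int fps \<Rightarrow> int"
  assumes f: "\<And>a b x y. f (of_int a * x + of_int b * y) = a * f x + b * f y"
    and g: "\<And>a b x y. g (of_int a * x + of_int b * y) = a * g x + b * g y"
  defines "v \<equiv> ev dissect_alpha2"
  shows "4 ^ Suc k dvd f ((two_step ^^ k) v) * g ((two_step ^^ Suc k) v) - f ((two_step ^^ Suc k) v) * g ((two_step ^^ k) v)"
proof -
  have v: "v \<in> lattice" unfolding v_def by (rule dissect_alpha2_lattice)
  obtain a y where y: "two_step v = of_int a * v + of_int 4 * y" "y \<in> lattice"
    using two_step_lattice[OF v] by (auto simp: target_def v_def)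
  have "(two_step ^^ Suc k) v = of_int a * (two_step ^^ k) v + of_int 4 * (two_step ^^ k) y"
    unfolding two_step_pow_linear[symmetric] y(1)[symmetric] by (simp add: funpow_swap1)
  hence "f ((two_step ^^ k) v) * g ((two_step ^^ Suc k) v) - f ((two_step ^^ Suc k) v) * g ((two_step ^^ k) v) =
      4 * (f ((two_step ^^ k) v) * g ((two_step ^^ k) y) - f ((two_step ^^ k) y) * g ((two_step ^^ k) v))"
    by (simp only: f g) (simp add: algebra_simps)
  thus ?thesis
    using two_step_pow_wedge[OF f g v y(2), of k] by (simp only: power_Suc mult_dvd_mono dvd_refl)
qed

section \<open>The generating function as an infinite product\<close>

definition Delta3 :: "int fps" where
  "Delta3 = Abs_fps broken_3_diamond"

lemma Delta3_eprod: "Delta3 = eprod (\<lambda>i. broken_3_diamond_factor (Suc i))"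
proof (rule fps_ext)
  fix n
  have "(\<lambda>n. \<Prod>i\<le>n. broken_3_diamond_factor (Suc i)) \<longlonglongrightarrow> Delta3"
    unfolding Delta3_def using broken_3_diamond_has_prod by (rule has_prod_imp_tendsto)
  hence "\<forall>\<^sub>F m in sequentially. fps_nth (\<Prod>i\<le>m. broken_3_diamond_factor (Suc i)) n = fps_nth Delta3 n"
    unfolding tendsto_fps_iff by blast
  hence "\<forall>\<^sub>F m in sequentially. m \<ge> n \<and> fps_nth (\<Prod>i\<le>m. broken_3_diamond_factor (Suc i)) n = fps_nth Delta3 n"
    using eventually_ge_at_top[of n] by eventually_elim simp
  then obtain m where "m \<ge> n" "fps_nth (\<Prod>i\<le>m. broken_3_diamond_factor (Suc i)) n = fps_nth Delta3 n"
    by (auto simp: eventually_sequentially)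
  thus "fps_nth Delta3 n = fps_nth (eprod (\<lambda>i. broken_3_diamond_factor (Suc i))) n"
    using broken_3_diamond_partial_prod_nth[of n m] by (simp add: eprod_def)
qed

lemma Delta3_mult: "Delta3 * (euler ^ 3 * dil 14 euler) = dil 2 euler * dil 7 euler"
proof -
  have tame: "tame (\<lambda>i. broken_3_diamond_factor (Suc i))"
    unfolding tame_def
  proof
    fix i
    show "fps_X ^ Suc i dvd broken_3_diamond_factor (Suc i) - 1"
      using broken_3_diamond_factor_eq_1_plus[of "Suc i"] by auto
  qed
  have e: "euler = eprod (\<lambda>i. 1 - fps_X ^ Suc i)" "tame (\<lambda>i. 1 - fps_X ^ Suc i)"
    using tame_euler[of 1] by (simp_all add: euler_def)
  note mult = eprod_mult tame_mult
  have "euler ^ 3 * dil 14 euler = eprod (\<lambda>i. broken_3_diamond_denom (Suc i))"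
    "tame (\<lambda>i. broken_3_diamond_denom (Suc i))"
    using e(2) tame_euler[of 14]
    by (simp_all add: e(1) dil_euler[unfolded e(1)] mult broken_3_diamond_denom_def power3_eq_cube del: power_Suc)
  hence "Delta3 * (euler ^ 3 * dil 14 euler) = eprod (\<lambda>i. broken_3_diamond_num (Suc i))"
    using tame by (simp add: Delta3_eprod eprod_mult broken_3_diamond_factor_mult_denom)
  also have "\<dots> = dil 2 euler * dil 7 euler"
    using tame_euler[of 2] tame_euler[of 7]
    by (simp add: dil_euler eprod_mult broken_3_diamond_num_def del: power_Suc)
  finally show ?thesis .
qed

section \<open>The eta quotients in front of the progressions\<close>

definition euler7 :: "int fps" where
  "euler7 = euler * dil 7 euler"

definition prefactor_even :: "int fps" where
  "prefactor_even = unit_inverse euler7"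

definition prefactor_odd :: "int fps" where
  "prefactor_odd = (dil 2 euler7)\<^sup>2 * unit_inverse euler7 ^ 3"

lemma euler7_nth_0 [simp]: "fps_nth euler7 0 = 1"
  by (simp add: euler7_def)

lemma euler7_nonzero [simp]: "euler7 \<noteq> 0" "dil c euler7 \<noteq> 0"
  by (auto intro!: fps_nth_0_imp_nonzero)

lemma prefactor_mult: "prefactor_even * euler7 = 1" "prefactor_odd * euler7 ^ 3 = (dil 2 euler7)\<^sup>2"
proof -
  have 1: "euler7 * unit_inverse euler7 = 1"
    by (rule mult_unit_inverse) simp
  thus "prefactor_even * euler7 = 1"
    by (simp add: prefactor_even_def mult.commute)
  from 1 show "prefactor_odd * euler7 ^ 3 = (dil 2 euler7)\<^sup>2"
    unfolding prefactor_odd_def by algebra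
qed

lemma psi_psi7_euler7:
  "psi_psi7 * euler7 = (dil 2 euler7)\<^sup>2" "alt psi_psi7 * dil 2 euler7 = euler7 * dil 4 euler7"
  "dil 2 psi_psi7 * dil 2 euler7 = (dil 4 euler7)\<^sup>2"
proof -
  have "dil 7 (psi * euler) = dil 7 ((dil 2 euler)\<^sup>2)" "dil 7 (alt psi * dil 2 euler) = dil 7 (euler * dil 4 euler)"
    by (simp_all only: psi_mult_euler alt_psi_euler)
  hence 7: "dil 7 psi * dil 7 euler = (dil 14 euler)\<^sup>2" "dil 7 (alt psi) * dil 14 euler = dil 7 euler * dil 28 euler"
    by (simp_all add: dil_simps)
  show 1: "psi_psi7 * euler7 = (dil 2 euler7)\<^sup>2"
    using 7(1) psi_mult_euler by (simp add: psi_psi7_def euler7_def dil_simps) algebra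
  show "alt psi_psi7 * dil 2 euler7 = euler7 * dil 4 euler7"
    using 7(2) alt_psi_euler by (simp add: psi_psi7_def euler7_def dil_simps alt_simps alt_dil_odd) algebra
  have "dil 2 (psi_psi7 * euler7) = dil 2 ((dil 2 euler7)\<^sup>2)"
    by (simp only: 1)
  thus "dil 2 psi_psi7 * dil 2 euler7 = (dil 4 euler7)\<^sup>2"
    by (simp add: dil_simps)
qed

lemma rho_euler7: "rho * euler7 = fps_X * dil 4 euler7"
proof -
  have "dil 4 euler7 * (rho * euler7) = dil 4 euler7 * (fps_X * dil 4 euler7)"
    using psi_psi7_euler7 rho_mult by algebra
  thus ?thesis by simp
qed

lemma dil_xi_euler7: "dil 2 xi * dil 2 euler7 ^ 3 = fps_X\<^sup>2 * dil 4 euler7 ^ 3"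
proof -
  have "(1 + 2 * rho) * euler7\<^sup>2 * dil 4 euler7 = dil 2 euler7 ^ 3"
    using psi_psi7_euler7 one_plus_rho_mult by algebra
  thus ?thesis using rho_square rho_euler7 by algebra
qed

text \<open>Relates a prefactor to the dilation of the other one by a power of \<open>rho\<close>.
  The powers 1 here and 3 in the next lemma lead to \<open>dissect F\<close> and
  \<open>dissect (rho\<^sup>2 * F)\<close> respectively.\<close>

lemma dil_xi_prefactor_even: "dil 2 xi * prefactor_even = fps_X * dil 2 prefactor_odd * rho"
proof -
  have "dil 2 (prefactor_odd * euler7 ^ 3) = dil 2 ((dil 2 euler7)\<^sup>2)"
    by (simp only: prefactor_mult)
  hence "dil 2 prefactor_odd * dil 2 euler7 ^ 3 = (dil 4 euler7)\<^sup>2"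
    by (simp add: dil_simps)
  hence "(euler7 * dil 2 euler7 ^ 3) * (dil 2 xi * prefactor_even) = (euler7 * dil 2 euler7 ^ 3) * (fps_X * dil 2 prefactor_odd * rho)"
    using prefactor_mult(1) dil_xi_euler7 rho_euler7 by algebra
  thus ?thesis by simp
qed

lemma dil_xi_prefactor_odd: "dil 2 xi * (fps_X * prefactor_odd) = dil 2 prefactor_even * rho ^ 3"
proof -
  have "dil 2 (prefactor_even * euler7) = dil 2 1"
    by (simp only: prefactor_mult)
  hence "dil 2 prefactor_even * dil 2 euler7 = 1"
    by (simp add: dil_simps)
  hence "(euler7 ^ 3 * dil 2 euler7) * (dil 2 xi * (fps_X * prefactor_odd)) = (euler7 ^ 3 * dil 2 euler7) * (dil 2 prefactor_even * rho ^ 3)"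
    using prefactor_mult(2) dil_xi_euler7 rho_euler7 by algebra
  thus ?thesis by simp
qed

text \<open>The generating function is f_2 f_7 / (f_1^3 f_14), and \<open>tau\<close> is f_2 f_7^2 /
  (f_1^2 f_14).\<close>

lemma Delta3_eq: "Delta3 = prefactor_even * tau"
proof -
  have "dil 7 (alt phi * dil 2 euler) = dil 7 (euler\<^sup>2)"
    by (simp only: alt_phi_mult_dil_euler)
  hence 7: "dil 7 (alt phi) * dil 14 euler = (dil 7 euler)\<^sup>2"
    by (simp add: dil_simps)
  have "euler\<^sup>2 * tau * dil 14 euler = (tau * alt phi) * dil 14 euler * dil 2 euler"
    by (simp add: mult_ac flip: alt_phi_mult_dil_euler)
  hence tau: "euler\<^sup>2 * tau * dil 14 euler = (dil 7 euler)\<^sup>2 * dil 2 euler"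
    by (simp only: tau_mult 7)
  have "(euler ^ 3 * dil 14 euler * dil 7 euler) * Delta3 = (euler ^ 3 * dil 14 euler * dil 7 euler) * (prefactor_even * tau)"
    using Delta3_mult tau prefactor_mult(1) unfolding euler7_def by algebra
  thus ?thesis by simp
qed

text \<open>\<open>kappa_mult\<close> replaces \<open>tau\<close> by \<open>kappa\<close> times a
  series in q^2. After multiplication by \<open>xi\<close>, the series in q^2 leave the odd part and
  \<open>dissect\<close> remains.\<close>

lemma odd_part_prefactor: "odd_part (prefactor_even * tau * F) = prefactor_odd * tau * dissect F"
proof -
  have "xi * odd_part (prefactor_even * tau * F) = odd_part ((dil 2 xi * prefactor_even) * tau * F)"
    by (simp only: odd_part_mult_dil[symmetric] mult.assoc)
  also have "(dil 2 xi * prefactor_even) * tau * F = dil 2 (prefactor_odd * tau) * (fps_X * (kappa * rho * F))"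
    unfolding dil_xi_prefactor_even by (subst kappa_mult[symmetric]) (simp add: dil_mult mult_ac)
  also have "odd_part \<dots> = prefactor_odd * tau * (xi * dissect F)"
    by (simp only: odd_part_mult_dil odd_part_X_mult xi_mult_dissect)
  also have "\<dots> = xi * (prefactor_odd * tau * dissect F)"
    by (simp add: mult_ac)
  finally show ?thesis by simp
qed

lemma even_part_prefactor: "even_part (fps_X * (prefactor_odd * tau * F)) = prefactor_even * tau * dissect (rho\<^sup>2 * F)"
proof -
  have "xi * even_part (fps_X * (prefactor_odd * tau * F)) = even_part ((dil 2 xi * (fps_X * prefactor_odd)) * tau * F)"
    by (simp only: even_part_mult_dil[symmetric] mult.assoc)
  also have "(dil 2 xi * (fps_X * prefactor_odd)) * tau * F = dil 2 (prefactor_even * tau) * (kappa * rho * (rho\<^sup>2 * F))"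
    unfolding dil_xi_prefactor_odd by (subst kappa_mult[symmetric]) (simp add: dil_mult power2_eq_square power3_eq_cube mult_ac)
  also have "even_part \<dots> = prefactor_even * tau * (xi * dissect (rho\<^sup>2 * F))"
    by (simp only: even_part_mult_dil xi_mult_dissect)
  also have "\<dots> = xi * (prefactor_even * tau * dissect (rho\<^sup>2 * F))"
    by (simp add: mult_ac)
  finally show ?thesis by simp
qed

section \<open>The arithmetic progressions and their recursion\<close>

definition progression :: "nat \<Rightarrow> int fps" where
  "progression a = Abs_fps (\<lambda>n. broken_3_diamond (2 ^ a * n + broken_3_diamond_lambda a))"

text \<open>For odd \<open>a\<close> the offset grows by \<open>2 ^ a\<close>, so the terms of odd
  index are kept; the factor X moves them to even exponents.\<close>

lemma progression_Suc_odd: "odd a \<Longrightarrow> fps_X * progression (Suc a) = even_part (fps_X * progression a)"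
proof (rule fps_ext)
  fix n assume a: "odd a"
  show "fps_nth (fps_X * progression (Suc a)) n = fps_nth (even_part (fps_X * progression a)) n"
  proof (cases n)
    case (Suc m)
    have "broken_3_diamond_lambda (Suc a) = broken_3_diamond_lambda a + 2 ^ a"
      using three_mult_broken_3_diamond_lambda[of a] three_mult_broken_3_diamond_lambda[of "Suc a"] a by simp
    hence "2 ^ a * (2 * m + 1) + broken_3_diamond_lambda a = 2 ^ Suc a * m + broken_3_diamond_lambda (Suc a)"
      by (simp add: algebra_simps)
    moreover have "fps_nth (fps_X * progression (Suc a)) n = fps_nth (progression (Suc a)) m"
      "fps_nth (fps_X * progression a) (2 * n) = fps_nth (progression a) (2 * m + 1)"
      by (simp_all add: Suc)
    ultimately show ?thesis by (simp only: progression_def even_part_def fps_nth_Abs_fps)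
  qed (simp add: even_part_def)
qed

text \<open>For even \<open>a\<close> the offset stays, so the terms of even index are kept; X moves
  them to odd exponents, as \<open>odd_part_prefactor\<close> expects.\<close>

lemma progression_Suc_even: "even a \<Longrightarrow> progression (Suc a) = odd_part (fps_X * progression a)"
proof -
  assume a: "even a"
  have "broken_3_diamond_lambda (Suc a) = broken_3_diamond_lambda a"
    using three_mult_broken_3_diamond_lambda[of a] three_mult_broken_3_diamond_lambda[of "Suc a"] a by simp
  thus ?thesis
    unfolding odd_part_X_mult by (simp add: fps_eq_iff progression_def even_part_def mult_ac)
qed

lemma progression_1: "progression 1 = prefactor_odd * tau * alpha"
proof -
  have "progression 1 = odd_part Delta3"
    by (simp add: fps_eq_iff progression_def odd_part_def Delta3_def broken_3_diamond_lambda_def)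
  also have "\<dots> = prefactor_odd * tau * alpha"
    using odd_part_prefactor[of 1] by (simp add: Delta3_eq dissect_1)
  finally show ?thesis .
qed

lemma progression_even: "fps_X * progression (2 * k + 2) = prefactor_even * tau * (two_step ^^ k) (ev dissect_alpha2)"
  and progression_odd: "progression (2 * k + 3) = prefactor_odd * tau * dissect ((two_step ^^ k) (ev dissect_alpha2))"
proof -
  \<comment> \<open>Stated for arbitrary \<open>F\<close>, since both the induction step and the
    second claim use it.\<close>
  have odd: "progression (2 * k + 3) = prefactor_odd * tau * dissect F"
    if "fps_X * progression (2 * k + 2) = prefactor_even * tau * F" for k F
  proof -
    have "progression (Suc (2 * k + 2)) = prefactor_odd * tau * dissect F"
      by (subst progression_Suc_even) (simp, simp only: that odd_part_prefactor)
    thus ?thesis by (simp add: numeral_3_eq_3)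
  qed
  show even: "fps_X * progression (2 * k + 2) = prefactor_even * tau * (two_step ^^ k) (ev dissect_alpha2)"
  proof (induction k)
    case 0
    have "fps_X * progression 2 = prefactor_even * tau * dissect (rho\<^sup>2 * alpha)"
      using progression_Suc_odd[of 1] progression_1 even_part_prefactor by (simp add: numeral_2_eq_2)
    hence "fps_X * progression 2 = prefactor_even * tau * ev dissect_alpha2"
      by (simp add: power2_eq_square mult.assoc dissect_initial)
    thus ?case by (simp add: numeral_2_eq_2)
  next
    case (Suc k)
    have "fps_X * progression (Suc (2 * k + 3)) = even_part (fps_X * progression (2 * k + 3))"
      by (rule progression_Suc_odd) simp
    also have "\<dots> = prefactor_even * tau * dissect (rho\<^sup>2 * dissect ((two_step ^^ k) (ev dissect_alpha2)))"
      unfolding odd[OF Suc] by (rule even_part_prefactor)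
    also have "\<dots> = prefactor_even * tau * (two_step ^^ Suc k) (ev dissect_alpha2)"
      by (simp flip: two_step_def)
    also have "Suc (2 * k + 3) = 2 * Suc k + 2" by simp
    finally show ?case .
  qed
  show "progression (2 * k + 3) = prefactor_odd * tau * dissect ((two_step ^^ k) (ev dissect_alpha2))"
    by (rule odd[OF even])
qed

theorem theorem4p9:
  fixes \<alpha> n :: nat
  assumes "\<alpha> \<ge> 1"
  shows "[broken_3_diamond (broken_3_diamond_lambda \<alpha>) *
            broken_3_diamond (2 ^ (\<alpha> + 2) * n + broken_3_diamond_lambda (\<alpha> + 2)) =
          broken_3_diamond (broken_3_diamond_lambda (\<alpha> + 2)) *
            broken_3_diamond (2 ^ \<alpha> * n + broken_3_diamond_lambda \<alpha>)]
         (mod 2 ^ (2 * (\<alpha> div 2)))"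
proof -
  have nth: "broken_3_diamond (2 ^ a * n + broken_3_diamond_lambda a) = fps_nth (progression a) n"
    "broken_3_diamond (broken_3_diamond_lambda a) = fps_nth (progression a) 0" for a n
    by (simp_all add: progression_def)
  \<comment> \<open>The two sides of the congruence differ by the minor formed from coefficients 0
    and \<open>n\<close> of two progressions.\<close>
  define c where "c = (\<lambda>a b i j. fps_nth (progression a) i * fps_nth (progression b) j)"
  have lin: "fps_nth (w * (of_int a * x + of_int b * y)) i = a * fps_nth (w * x) i + b * fps_nth (w * y) i"
    for w x y :: "int fps" and a b :: int and i
  proof -
    have "w * (of_int a * x + of_int b * y) = fps_const a * (w * x) + fps_const b * (w * y)"
      by (simp add: algebra_simps flip: fps_of_int)
    thus ?thesis by simp
  qed
  define v where "v = ev dissect_alpha2"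
  consider "\<alpha> = 1" | k where "\<alpha> = 2 * k + 2" | k where "\<alpha> = 2 * k + 3"
  proof -
    have "\<alpha> = 1 \<or> (\<exists>k. \<alpha> = 2 * k + 2) \<or> (\<exists>k. \<alpha> = 2 * k + 3)"
      using assms by presburger
    thus ?thesis using that by blast
  qed
  hence "4 ^ (\<alpha> div 2) dvd c \<alpha> (\<alpha> + 2) 0 n - c (\<alpha> + 2) \<alpha> 0 n"
  proof cases
    case 2
    \<comment> \<open>\<open>Suc i\<close> undoes the factor X in
      \<open>progression_even\<close>.\<close>
    define f where "f = (\<lambda>i F. fps_nth (prefactor_even * tau * F) (Suc i))"
    have seq: "fps_nth (progression (2 * k + 2)) i = f i ((two_step ^^ k) v)" for i k
      unfolding f_def v_def progression_even[symmetric] by simp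
    have "2 * k + 2 + 2 = 2 * Suc k + 2" by simp
    hence seq': "fps_nth (progression (2 * k + 2 + 2)) i = f i ((two_step ^^ Suc k) v)" for i
      by (simp only: seq)
    have d: "\<alpha> div 2 = Suc k" using 2 by simp
    show ?thesis
      unfolding d unfolding c_def 2 seq seq' v_def
      by (rule two_step_pow_consecutive[of "f 0" "f n"]) (simp_all only: f_def lin)
  next
    case 3
    define f where "f = (\<lambda>i F. fps_nth (prefactor_odd * tau * dissect F) i)"
    have dissect_lin: "dissect (of_int a * x + of_int b * y) = of_int a * dissect x + of_int b * dissect y" for a b x y
      by (simp only: dissect_add dissect_of_int)
    have seq: "fps_nth (progression (2 * k + 3)) i = f i ((two_step ^^ k) v)" for i k
      unfolding f_def v_def progression_odd ..
    have "2 * k + 3 + 2 = 2 * Suc k + 3" by simp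
    hence seq': "fps_nth (progression (2 * k + 3 + 2)) i = f i ((two_step ^^ Suc k) v)" for i
      by (simp only: seq)
    have d: "\<alpha> div 2 = Suc k" using 3 by simp
    show ?thesis
      unfolding d unfolding c_def 3 seq seq' v_def
      by (rule two_step_pow_consecutive[of "f 0" "f n"]) (simp_all only: f_def dissect_lin lin)
  \<comment> \<open>The remaining case \<alpha> = 1 has modulus 1.\<close>
  qed simp
  thus ?thesis
    unfolding nth power_mult cong_iff_dvd_diff by (simp add: c_def)
qed

end
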